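(* There is a universal constant $K$ such that for every integer $M\ge1$ and every nonempty subset $T$ of $\mathbb R^M$, $$\gamma_{1/2}(T)\le K\big(b(T)+\gamma_1(T,\|\cdot\|_\infty)\big).$$
   Context: For a metric space $(T,d)$, $\alpha>0$, set $$\gamma_{\alpha}(T,d)=\inf_\mu\sup_{x\in T}\int_0^\infty\Big(\log\frac1{\mu(B(x,\varepsilon))}\Big)^{\alpha}d\varepsilon ,$$ where $B(x,\varepsilon)$ is the closed ball for $d$ and the infimum is over probability measures $\mu$ on $T$ for which balls are measurable (equivalently, supported by a countable set). For $T\subset\mathbb R^M$, $\gamma_{1/2}(T)$ means $\gamma_{1/2}(T,\|\cdot\|_2)$ (Euclidean distance), and $\gamma_1(T,\|\cdot\|_\infty)$ uses the distance of the supremum norm. With $(\varepsilon_i)_{i\le M}$ independent random variables, $P(\varepsilon_i=1)=P(\varepsilon_i=-1)=1/2$, $$b(T)=\sup\Big\{E\sup_{t\in S}\sum_{i\le M}\varepsilon_it_i:\ S\subset T,\ S\text{ finite}\Big\}.$$ *)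

theory Defs
  imports "HOL-Probability.Probability"
begin

definition ball_measures :: "'a set \<Rightarrow> ('a \<Rightarrow> 'a \<Rightarrow> real) \<Rightarrow> 'a measure set"
  where "ball_measures T d =
    {\<mu>. prob_space \<mu> \<and> space \<mu> = T \<and> (\<forall>x\<in>T. \<forall>\<epsilon>. Metric_space.mcball T d x \<epsilon> \<in> sets \<mu>)}"

text \<open>
  \<open>(log (1/p))\<^sup>\<alpha>\<close> for a probability \<open>p\<close> and \<open>\<alpha> > 0\<close>. Since \<open>1 / 0 = 0\<close> in HOL, the value
  \<open>\<infinity>\<close> at \<open>p = 0\<close> has to be prescribed.
\<close>
definition log_inv_powr :: "real \<Rightarrow> real \<Rightarrow> ennreal"
  where "log_inv_powr \<alpha> p = (if p = 0 then \<infinity> else ennreal (ln (1 / p) powr \<alpha>))"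

definition \<gamma> :: "real \<Rightarrow> 'a set \<Rightarrow> ('a \<Rightarrow> 'a \<Rightarrow> real) \<Rightarrow> ennreal"
  where "\<gamma> \<alpha> T d =
    (INF \<mu>\<in>ball_measures T d. SUP x\<in>T.
      (\<integral>\<^sup>+\<epsilon>\<in>{0..}. log_inv_powr \<alpha> (measure \<mu> (Metric_space.mcball T d x \<epsilon>)) \<partial>lborel))"

text \<open>
  As the constant in the theorem must not depend on the dimension \<open>M\<close>, a vector of \<open>\<real>\<^sup>M\<close> is a
  sequence \<open>x :: nat \<Rightarrow> real\<close> with coordinates indexed by \<open>i < M\<close> and \<open>x i = 0\<close> for \<open>i \<ge> M\<close>;
  \<open>\<real>\<^sup>M\<close> itself is \<open>topspace (Euclidean_space M)\<close>.
\<close>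
definition dist2 :: "nat \<Rightarrow> (nat \<Rightarrow> real) \<Rightarrow> (nat \<Rightarrow> real) \<Rightarrow> real"
  where "dist2 M x y = L2_set (\<lambda>i. x i - y i) {..<M}"

definition dist_sup :: "nat \<Rightarrow> (nat \<Rightarrow> real) \<Rightarrow> (nat \<Rightarrow> real) \<Rightarrow> real"
  where "dist_sup M x y = Max ((\<lambda>i. \<bar>x i - y i\<bar>) ` {..<M})"

text \<open>The joint law of \<open>M\<close> independent uniform random signs.\<close>
definition signs :: "nat \<Rightarrow> (nat \<Rightarrow> real) pmf"
  where "signs M = Pi_pmf {..<M} 0 (\<lambda>_. pmf_of_set {-1, 1})"

definition expected_max :: "nat \<Rightarrow> (nat \<Rightarrow> real) set \<Rightarrow> real"
  where "expected_max M S =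
    measure_pmf.expectation (signs M) (\<lambda>\<epsilon>. Max ((\<lambda>t. \<Sum>i<M. \<epsilon> i * t i) ` S))"

text \<open>
  The empty \<open>S\<close> is left out, as \<open>Max {}\<close> is unspecified. The coercion to \<^typ>\<open>ennreal\<close> does not
  truncate anything: see \<open>expected_max_nonneg\<close> below.
\<close>
definition b :: "nat \<Rightarrow> (nat \<Rightarrow> real) set \<Rightarrow> ennreal"
  where "b M T = (SUP S\<in>{S. S \<subseteq> T \<and> finite S \<and> S \<noteq> {}}. ennreal (expected_max M S))"

lemma Metric_space_dist2: "Metric_space (topspace (Euclidean_space M)) (dist2 M)"
proof
  fix x y z :: "nat \<Rightarrow> real"
  show "0 \<le> dist2 M x y"
    by (simp add: dist2_def)
  show "dist2 M x y = dist2 M y x"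
    by (simp add: dist2_def L2_set_def power2_commute)
  show "dist2 M x z \<le> dist2 M x y + dist2 M y z"
    using L2_set_triangle_ineq[of "\<lambda>i. x i - y i" "\<lambda>i. y i - z i" "{..<M}"]
    by (simp add: dist2_def)
  assume "x \<in> topspace (Euclidean_space M)" "y \<in> topspace (Euclidean_space M)"
  then have "x = y \<longleftrightarrow> (\<forall>i<M. x i = y i)"
    by (auto simp: topspace_Euclidean_space fun_eq_iff) (metis not_le)
  then show "dist2 M x y = 0 \<longleftrightarrow> x = y"
    by (auto simp: dist2_def L2_set_eq_0_iff)
qed

lemma Metric_space_dist_sup:
  assumes "M \<ge> 1"
  shows "Metric_space (topspace (Euclidean_space M)) (dist_sup M)"
proof
  have ne: "(\<lambda>i. f i) ` {..<M} \<noteq> {}" for f :: "nat \<Rightarrow> real"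
    using assms by (auto simp: lessThan_empty_iff)
  have ub: "\<bar>x i - y i\<bar> \<le> dist_sup M x y" if "i < M" for x y i
    unfolding dist_sup_def using that by (intro Max_ge) auto
  fix x y z :: "nat \<Rightarrow> real"
  show nn: "0 \<le> dist_sup M x y"
    using ub[of 0 x y] assms by auto
  show "dist_sup M x y = dist_sup M y x"
    by (simp add: dist_sup_def abs_minus_commute)
  show "dist_sup M x z \<le> dist_sup M x y + dist_sup M y z"
  proof -
    have "\<bar>x i - z i\<bar> \<le> dist_sup M x y + dist_sup M y z" if "i < M" for i
      using ub[OF that, of x y] ub[OF that, of y z] by linarith
    then show ?thesis
      by (subst (1) dist_sup_def) (use ne in \<open>auto intro!: Max.boundedI\<close>)
  qed
  assume "x \<in> topspace (Euclidean_space M)" "y \<in> topspace (Euclidean_space M)"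
  then have eq: "x = y \<longleftrightarrow> (\<forall>i<M. x i = y i)"
    by (auto simp: topspace_Euclidean_space fun_eq_iff) (metis not_le)
  show "dist_sup M x y = 0 \<longleftrightarrow> x = y"
  proof
    assume "dist_sup M x y = 0"
    then show "x = y"
      unfolding eq using ub[of _ x y] by fastforce
  next
    assume "x = y"
    then have "dist_sup M x y \<le> 0"
      unfolding dist_sup_def using ne by (intro Max.boundedI) auto
    with nn show "dist_sup M x y = 0"
      by simp
  qed
qed

lemma expected_max_nonneg:
  assumes "finite S" "S \<noteq> {}"
  shows "0 \<le> expected_max M S"
proof -
  from assms obtain t where t: "t \<in> S"
    by blast
  have fin: "finite (set_pmf (signs M))"
    unfolding signs_def by (subst set_Pi_pmf) (auto intro!: finite_PiE_dflt)
  note int [simp] = integrable_measure_pmf_finite[OF fin]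
  have "measure_pmf.expectation (signs M) (\<lambda>\<epsilon>. \<epsilon> i) = 0" if "i < M" for i
  proof -
    have "measure_pmf.expectation (signs M) (\<lambda>\<epsilon>. \<epsilon> i) =
        measure_pmf.expectation (map_pmf (\<lambda>\<epsilon>. \<epsilon> i) (signs M)) (\<lambda>v. v)"
      by simp
    also have "map_pmf (\<lambda>\<epsilon>. \<epsilon> i) (signs M) = pmf_of_set {-1, 1}"
      using that by (simp add: signs_def Pi_pmf_component)
    finally show ?thesis
      by (simp add: integral_pmf_of_set)
  qed
  then have "0 = measure_pmf.expectation (signs M) (\<lambda>\<epsilon>. \<Sum>i<M. \<epsilon> i * t i)"
    by (simp add: Bochner_Integration.integral_sum)
  also have "\<dots> \<le> expected_max M S"
    unfolding expected_max_def using assms t by (intro integral_mono) (auto intro!: Max_ge)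
  finally show ?thesis .
qed

end

theory Submission
  imports Defs
begin

text \<open>
  For a probability \<open>\<nu>\<close> that nearly attains \<open>\<gamma>\<^sub>1(T, dist_sup)\<close>, one builds a tree of finite covers of
  \<open>T\<close>, level \<open>n\<close> having at most \<open>exp (2 * 4\<^sup>n)\<close> pieces, such that along every branch the sum of
  \<open>2\<^sup>n\<close> times the radius of the piece is at most a constant times \<open>b(T) + \<gamma>\<^sub>1(T, dist_sup)\<close>; a
  measure spread over the pieces then bounds \<open>\<gamma>\<^sub>1\<^sub>/\<^sub>2\<close>. In a piece of radius \<open>a\<close>, the points whose sup
  norm ball of radius about \<open>a / 2\<^sup>n\<close> has \<open>\<nu>\<close>-measure below \<open>exp (-4\<^sup>n)\<close> stay together, and their cost
  \<open>2\<^sup>n a\<close> is charged to the \<open>\<gamma>\<^sub>1\<close> integral. The others fall into at most \<open>exp (4\<^sup>n)\<close> parts of sup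
  norm diameter of order \<open>a / 2\<^sup>n\<close>. In such a part, Sudakov minoration combined with concentration
  shows that the points around which the expected supremum is nearly as large as on the whole piece
  are covered by few balls of radius \<open>a / 256\<close>, and around all remaining points it is smaller by a
  fixed multiple of \<open>2\<^sup>n a\<close>, which pays for keeping the radius.
\<close>

section \<open>Random signs\<close>

text \<open>The exponents balance: where a sup norm ball of radius about a / 2^n has mass below exp
  (-4^n), the integral of exponent 1 collects about 4^n * a / 2^n = 2^n a. This is also the cost of
  radius a at level n, since the root of the log of the number of pieces is of order 2^n. The sup
  norm enters because a sign can be biased by at most 1: on a set of diameter a, a tilt of strength
  2^n / a needs coordinate differences of at most a / 2^n.

  The obstacle is that a rise of the expected supremum is seen only on much smaller balls. With
  separation \<open>rad\<close> / 256 Sudakov yields 2^n \<open>rad\<close> / 2^20, while the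
  fluctuation of the suprema over balls of radius r costs 8 * 2^n r. For r = \<open>rad\<close> /
  256^2 that is too much; for r = \<open>rad\<close> / 256^3 it is half of the yield. So a gain is
  known only three scales below the piece and reaches the width of the piece itself after three
  shrinkings, which is why widths at four scales are recorded. That the fluctuation depends on the
  Euclidean radius alone, with no sup norm condition, is due to the convexity of suprema of linear
  forms.\<close>

abbreviation sign_exp :: "nat \<Rightarrow> ((nat \<Rightarrow> real) \<Rightarrow> real) \<Rightarrow> real"
  where "sign_exp M f \<equiv> measure_pmf.expectation (signs M) f"

abbreviation ip :: "nat \<Rightarrow> (nat \<Rightarrow> real) \<Rightarrow> (nat \<Rightarrow> real) \<Rightarrow> real"
  where "ip M x y \<equiv> (\<Sum>i<M. x i * y i)"

lemma finite_set_pmf_signs: "finite (set_pmf (signs M))"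
  unfolding signs_def by (subst set_Pi_pmf) (auto intro!: finite_PiE_dflt)

lemma integrable_signs [simp]: "integrable (measure_pmf (signs M)) (f :: _ \<Rightarrow> real)"
  by (rule integrable_measure_pmf_finite[OF finite_set_pmf_signs])

lemma abs_sign_le_1:
  assumes "\<epsilon> \<in> set_pmf (signs M)"
  shows "\<bar>\<epsilon> i\<bar> \<le> 1"
proof -
  have "\<epsilon> \<in> PiE_dflt {..<M} 0 (set_pmf \<circ> (\<lambda>_. pmf_of_set {-1, 1}))"
    using assms unfolding signs_def by (subst (asm) set_Pi_pmf) auto
  then show ?thesis
    by (cases "i < M") (auto simp: PiE_dflt_def dest: spec[of _ i])
qed

text \<open>\<open>signs\<close> puts 0 in the coordinates from M on, so the bound by 1 holds at
  every index, which is what the later pointwise comparisons use.\<close>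

lemma sign_exp_mono:
  assumes "\<And>\<epsilon>. (\<And>i. \<bar>\<epsilon> i\<bar> \<le> 1) \<Longrightarrow> f \<epsilon> \<le> g \<epsilon>"
  shows "sign_exp M f \<le> sign_exp M g"
  using assms abs_sign_le_1 by (intro integral_mono_AE) (auto simp: AE_measure_pmf_iff)

lemma sign_exp_0: "sign_exp 0 f = f (\<lambda>_. 0)"
  by (simp add: signs_def pmf_Pi_empty)

text \<open>Conditioning on the last sign; the inductions over the dimension run on this
  identity.\<close>

lemma sign_exp_Suc:
  "sign_exp (Suc M) f =
    (sign_exp M (\<lambda>\<epsilon>. f (\<epsilon>(M := 1))) + sign_exp M (\<lambda>\<epsilon>. f (\<epsilon>(M := -1)))) / 2"
proof -
  have "signs (Suc M) =
      bind_pmf (pmf_of_set {-1, 1}) (\<lambda>v. map_pmf (\<lambda>\<epsilon>. \<epsilon>(M := v)) (signs M))"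
    unfolding signs_def lessThan_Suc map_pmf_def
    by (subst Pi_pmf_insert') auto
  then have "sign_exp (Suc M) f =
      measure_pmf.expectation (pmf_of_set {-1, 1 :: real})
        (\<lambda>v. sign_exp M (\<lambda>\<epsilon>. f (\<epsilon>(M := v))))"
    using finite_set_pmf_signs[of "Suc M"]
    by (simp add: pmf_expectation_bind[where A = "{-1, 1}"] finite_set_pmf_signs
        integral_pmf_of_set)
  then show ?thesis
    by (simp add: integral_pmf_of_set add.commute)
qed

lemma sign_exp_prod:
  "sign_exp M (\<lambda>\<epsilon>. \<Prod>i<M. h i (\<epsilon> i)) = (\<Prod>i<M. (h i 1 + h i (-1)) / 2)"
proof (induction M)
  case (Suc M)
  have "(\<Prod>i<M. h i ((\<epsilon>(M := v)) i)) = (\<Prod>i<M. h i (\<epsilon> i))" for \<epsilon> v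
    by (intro prod.cong) auto
  then show ?case
    by (simp add: sign_exp_Suc Suc.IH field_simps)
qed (simp add: sign_exp_0)

lemma ip_fun_upd: "ip (Suc M) (x(M := v)) t = ip M x t + v * t M"
proof -
  have "ip M (x(M := v)) t = ip M x t"
    by (intro sum.cong) auto
  then show ?thesis
    by simp
qed

lemma sign_exp_ip: "sign_exp M (\<lambda>\<epsilon>. ip M \<epsilon> t) = 0"
proof (induction M)
  case (Suc M)
  have "sign_exp M (\<lambda>\<epsilon>. ip M \<epsilon> t + v) = v" for v
    by (subst Bochner_Integration.integral_add) (simp_all only: integrable_signs Suc.IH, simp)
  then show ?case
    by (simp only: sign_exp_Suc ip_fun_upd) simp
qed (simp add: sign_exp_0)

text \<open>Jensen's inequality, from the tangent to exp at the mean.\<close>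

lemma sign_exp_exp_ge: "exp (sign_exp M f) \<le> sign_exp M (\<lambda>\<epsilon>. exp (f \<epsilon>))"
proof -
  let ?m = "sign_exp M f"
  have "exp ?m * (1 + (x - ?m)) \<le> exp x" for x
    using mult_left_mono[OF exp_ge_add_one_self[of "x - ?m"], of "exp ?m"]
    by (simp flip: exp_add)
  then have "sign_exp M (\<lambda>\<epsilon>. exp ?m * (1 + (f \<epsilon> - ?m))) \<le> sign_exp M (\<lambda>\<epsilon>. exp (f \<epsilon>))"
    by (intro sign_exp_mono)
  then show ?thesis
    by simp
qed

text \<open>Convexity is asked on the whole space, because the functions are also evaluated at
  tilted and doubled sign vectors, which leave the cube.\<close>

definition cvx :: "((nat \<Rightarrow> real) \<Rightarrow> real) \<Rightarrow> bool"
  where "cvx f \<longleftrightarrow> (\<forall>x y s. 0 \<le> s \<longrightarrow> s \<le> 1 \<longrightarrow>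
    f (\<lambda>i. s * x i + (1 - s) * y i) \<le> s * f x + (1 - s) * f y)"

lemma cvxD:
  "cvx f \<Longrightarrow> 0 \<le> s \<Longrightarrow> s \<le> 1 \<Longrightarrow>
    f (\<lambda>i. s * x i + (1 - s) * y i) \<le> s * f x + (1 - s) * f y"
  by (simp add: cvx_def)

lemma cvx_fun_upd:
  assumes "cvx f"
  shows "cvx (\<lambda>x. f (x(k := v)))"
  unfolding cvx_def
proof (intro allI impI)
  fix x y :: "nat \<Rightarrow> real" and s :: real assume s: "0 \<le> s" "s \<le> 1"
  have "(\<lambda>i. s * x i + (1 - s) * y i)(k := v) =
      (\<lambda>i. s * (x(k := v)) i + (1 - s) * (y(k := v)) i)"
    by (auto simp: algebra_simps)
  then show "f ((\<lambda>i. s * x i + (1 - s) * y i)(k := v)) \<le>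
      s * f (x(k := v)) + (1 - s) * f (y(k := v))"
    using cvxD[OF assms s] by metis
qed

text \<open>
  The left-hand side is the mean of \<open>f\<close> at a centred vector with independent two-valued
  coordinates, which lie in \<open>[-2, 2]\<close>.
\<close>
lemma sign_exp_tilted_le:
  fixes \<theta> :: "nat \<Rightarrow> real"
  assumes "cvx f" and \<theta>: "\<And>i. i < M \<Longrightarrow> \<bar>\<theta> i\<bar> \<le> 1"
  shows "sign_exp M (\<lambda>\<epsilon>. (\<Prod>i<M. 1 + \<theta> i * \<epsilon> i) * f (\<lambda>i. if i < M then \<epsilon> i - \<theta> i else 0))
    \<le> sign_exp M (\<lambda>\<epsilon>. f (\<lambda>i. if i < M then 2 * \<epsilon> i else 0))"
  using assms
proof (induction M arbitrary: f)
  case (Suc M)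
  define p where "p = (\<lambda>\<epsilon>. \<Prod>i<M. 1 + \<theta> i * \<epsilon> i)"
  define c where "c = (\<lambda>\<epsilon> :: nat \<Rightarrow> real. \<lambda>i. if i < M then \<epsilon> i - \<theta> i else 0)"
  define d where "d = (\<lambda>\<epsilon> :: nat \<Rightarrow> real. \<lambda>i. if i < M then 2 * \<epsilon> i else 0)"
  let ?t = "\<theta> M"
  have t: "\<bar>?t\<bar> \<le> 1" using Suc.prems by auto
  have IH: "sign_exp M (\<lambda>\<epsilon>. p \<epsilon> * f ((c \<epsilon>)(M := v))) \<le> sign_exp M (\<lambda>\<epsilon>. f ((d \<epsilon>)(M := v)))" for v
    unfolding p_def c_def d_def using Suc.prems
    by (intro Suc.IH[of "\<lambda>x. f (x(M := v))"] cvx_fun_upd) auto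
  have c': "(\<lambda>i. if i < Suc M then (\<epsilon>(M := v)) i - \<theta> i else 0) = (c \<epsilon>)(M := v - ?t)" for v \<epsilon>
    by (auto simp: c_def)
  have d': "(\<lambda>i. if i < Suc M then 2 * (\<epsilon>(M := v)) i else 0) = (d \<epsilon>)(M := 2 * v)" for v \<epsilon>
    by (auto simp: d_def)
  have p': "(\<Prod>i<Suc M. 1 + \<theta> i * (\<epsilon>(M := v)) i) = p \<epsilon> * (1 + ?t * v)" for v \<epsilon>
    by (simp add: p_def)
  \<comment> \<open>Moving a coordinate from [-2, 2] to the endpoints in a mean-preserving way can
    only raise a convex function. The tilted coordinate is centred, so both endpoints end up with
    weight 1/2.\<close>
  have cv: "f (x(M := v)) \<le> (2 + v) / 4 * f (x(M := 2)) + (2 - v) / 4 * f (x(M := -2))"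
    if "\<bar>v\<bar> \<le> 2" for x v
  proof -
    define s where "s = (2 + v) / 4"
    have s: "0 \<le> s" "s \<le> 1" "1 - s = (2 - v) / 4"
      using that by (auto simp: s_def field_simps)
    have "(\<lambda>i. s * (x(M := 2)) i + (1 - s) * (x(M := -2)) i) = x(M := v)"
      by (auto simp: s_def field_simps)
    with cvxD[OF Suc.prems(1) s(1,2), of "x(M := 2)" "x(M := -2)"] show ?thesis
      by (simp only: s(3)) (simp only: s_def)
  qed
  have "sign_exp (Suc M) (\<lambda>\<epsilon>. (\<Prod>i<Suc M. 1 + \<theta> i * \<epsilon> i) *
      f (\<lambda>i. if i < Suc M then \<epsilon> i - \<theta> i else 0)) =
      ((1 + ?t) * sign_exp M (\<lambda>\<epsilon>. p \<epsilon> * f ((c \<epsilon>)(M := 1 - ?t))) +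
       (1 - ?t) * sign_exp M (\<lambda>\<epsilon>. p \<epsilon> * f ((c \<epsilon>)(M := -1 - ?t)))) / 2"
    unfolding sign_exp_Suc c' p'
    by (simp flip: integral_mult_right_zero add: mult_ac)
  also have "\<dots> \<le> ((1 + ?t) * sign_exp M (\<lambda>\<epsilon>. f ((d \<epsilon>)(M := 1 - ?t))) +
       (1 - ?t) * sign_exp M (\<lambda>\<epsilon>. f ((d \<epsilon>)(M := -1 - ?t)))) / 2"
    using t by (intro divide_right_mono add_mono mult_left_mono IH) auto
  also have "\<dots> = sign_exp M (\<lambda>\<epsilon>. ((1 + ?t) * f ((d \<epsilon>)(M := 1 - ?t)) +
       (1 - ?t) * f ((d \<epsilon>)(M := -1 - ?t))) / 2)"
    by simp
  also have "\<dots> \<le> sign_exp M (\<lambda>\<epsilon>. (f ((d \<epsilon>)(M := 2)) + f ((d \<epsilon>)(M := -2))) / 2)"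
  proof (rule sign_exp_mono)
    fix \<epsilon>
    let ?a = "f ((d \<epsilon>)(M := 2))" and ?b = "f ((d \<epsilon>)(M := -2))"
    have "(1 + ?t) * f ((d \<epsilon>)(M := 1 - ?t)) + (1 - ?t) * f ((d \<epsilon>)(M := -1 - ?t)) \<le>
        (1 + ?t) * ((2 + (1 - ?t)) / 4 * ?a + (2 - (1 - ?t)) / 4 * ?b) +
        (1 - ?t) * ((2 + (-1 - ?t)) / 4 * ?a + (2 - (-1 - ?t)) / 4 * ?b)"
      using t by (intro add_mono mult_left_mono cv) auto
    also have "\<dots> \<le> ?a + ?b"
      by (simp add: field_simps)
    finally show "((1 + ?t) * f ((d \<epsilon>)(M := 1 - ?t)) + (1 - ?t) * f ((d \<epsilon>)(M := -1 - ?t))) / 2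
        \<le> (?a + ?b) / 2"
      by simp
  qed
  also have "\<dots> = sign_exp (Suc M) (\<lambda>\<epsilon>. f (\<lambda>i. if i < Suc M then 2 * \<epsilon> i else 0))"
    unfolding sign_exp_Suc d' by simp
  finally show ?case .
qed (simp add: sign_exp_0)

section \<open>Support functions of finite sets and their mean over the signs\<close>

definition hmax :: "nat \<Rightarrow> (nat \<Rightarrow> real) set \<Rightarrow> (nat \<Rightarrow> real) \<Rightarrow> real"
  where "hmax M S x = Max ((\<lambda>t. ip M x t) ` S)"

lemma expected_max_hmax: "expected_max M S = sign_exp M (hmax M S)"
  by (simp add: expected_max_def hmax_def[abs_def])

lemma hmax_ge: "finite S \<Longrightarrow> t \<in> S \<Longrightarrow> ip M x t \<le> hmax M S x"
  by (simp add: hmax_def)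

lemma hmax_le: "finite S \<Longrightarrow> S \<noteq> {} \<Longrightarrow> (\<And>t. t \<in> S \<Longrightarrow> ip M x t \<le> c) \<Longrightarrow> hmax M S x \<le> c"
  by (simp add: hmax_def)

lemma hmax_mono: "finite S' \<Longrightarrow> S \<subseteq> S' \<Longrightarrow> S \<noteq> {} \<Longrightarrow> hmax M S x \<le> hmax M S' x"
  by (rule hmax_le) (auto intro: hmax_ge finite_subset)

lemma expected_max_mono:
  "finite S' \<Longrightarrow> S \<subseteq> S' \<Longrightarrow> S \<noteq> {} \<Longrightarrow> expected_max M S \<le> expected_max M S'"
  unfolding expected_max_hmax by (intro sign_exp_mono hmax_mono)

lemma ip_diff_right: "ip M x (\<lambda>i. t i - c i) = ip M x t - ip M x c"
  by (simp add: algebra_simps sum_subtractf)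

lemma hmax_translate:
  assumes "finite S" "S \<noteq> {}"
  shows "hmax M ((\<lambda>t i. t i - c i) ` S) x = hmax M S x - ip M x c"
proof (rule antisym)
  show "hmax M ((\<lambda>t i. t i - c i) ` S) x \<le> hmax M S x - ip M x c"
    using assms hmax_ge[of S _ x M] by (intro hmax_le) (auto simp: ip_diff_right)
  have "hmax M S x \<le> hmax M ((\<lambda>t i. t i - c i) ` S) x + ip M x c"
  proof (rule hmax_le[OF assms])
    fix t assume "t \<in> S"
    then have "ip M x (\<lambda>i. t i - c i) \<le> hmax M ((\<lambda>t i. t i - c i) ` S) x"
      using assms by (intro hmax_ge) auto
    then show "ip M x t \<le> hmax M ((\<lambda>t i. t i - c i) ` S) x + ip M x c"
      by (simp add: ip_diff_right)
  qed
  then show "hmax M S x - ip M x c \<le> hmax M ((\<lambda>t i. t i - c i) ` S) x"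
    by simp
qed

text \<open>A translation only adds a linear term of mean zero. This allows sets to be recentred at
  one of their points.\<close>

lemma expected_max_translate:
  assumes "finite S" "S \<noteq> {}"
  shows "expected_max M ((\<lambda>t i. t i - c i) ` S) = expected_max M S"
proof -
  have "sign_exp M (\<lambda>x. hmax M S x - ip M x c) = sign_exp M (hmax M S) - sign_exp M (\<lambda>x. ip M x c)"
    by (intro Bochner_Integration.integral_diff integrable_signs)
  then show ?thesis
    unfolding expected_max_hmax by (simp only: hmax_translate[OF assms, abs_def] sign_exp_ip diff_0_right)
qed

lemma cvx_hmax:
  assumes "finite S" "S \<noteq> {}"
  shows "cvx (hmax M S)"
  unfolding cvx_def
proof (intro allI impI hmax_le[OF assms])
  fix x y :: "nat \<Rightarrow> real" and s :: real and t assume s: "0 \<le> s" "s \<le> 1" and t: "t \<in> S"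
  have "ip M (\<lambda>i. s * x i + (1 - s) * y i) t = s * ip M x t + (1 - s) * ip M y t"
    by (simp add: algebra_simps sum.distrib sum_distrib_left sum_subtractf)
  also have "\<dots> \<le> s * hmax M S x + (1 - s) * hmax M S y"
    using s t assms by (intro add_mono mult_left_mono hmax_ge) auto
  finally show "ip M (\<lambda>i. s * x i + (1 - s) * y i) t \<le> s * hmax M S x + (1 - s) * hmax M S y" .
qed

lemma ip_cong_left: "(\<And>i. i < M \<Longrightarrow> x i = y i) \<Longrightarrow> ip M x t = ip M y t"
  by (intro sum.cong) auto

lemma dist2_power2: "(dist2 M x y)\<^sup>2 = (\<Sum>i<M. (x i - y i)\<^sup>2)"
  by (simp add: dist2_def L2_set_def sum_nonneg)

lemma ip_diff_le_dist2: "ip M x t - ip M x s \<le> L2_set x {..<M} * dist2 M t s"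
proof -
  have "ip M x t - ip M x s \<le> (\<Sum>i<M. \<bar>x i\<bar> * \<bar>t i - s i\<bar>)"
    unfolding ip_diff_right[symmetric] by (intro sum_mono) (auto simp flip: abs_mult)
  also have "\<dots> \<le> L2_set x {..<M} * dist2 M t s"
    using L2_set_mult_ineq[of x "\<lambda>i. t i - s i"] by (simp add: dist2_def)
  finally show ?thesis .
qed

section \<open>Sudakov minoration\<close>

text \<open>
  Sudakov minoration at a single scale. Tilting the signs towards \<open>t\<close> gives the law with density
  \<open>\<Prod>(1 + \<kappa> t\<^sub>i \<epsilon>\<^sub>i)\<close>, under which the maximizer of \<open>\<langle>\<epsilon>, t\<rangle> - \<kappa>|t|\<^sup>2 / 2\<close> recovers \<open>t\<close> with probability
  at least 1/2; as the recovery events are disjoint and the densities have second moment at most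
  \<open>exp (\<kappa>\<^sup>2 R\<^sup>2)\<close>, there are few of them.
\<close>
lemma local_sudakov:
  fixes Q :: "(nat \<Rightarrow> real) set"
  assumes fin: "finite Q" and kap: "\<kappa> > 0" and a: "a > 0"
    and R: "\<And>t. t \<in> Q \<Longrightarrow> (\<Sum>i<M. (t i)\<^sup>2) \<le> R\<^sup>2"
    and D: "\<And>t i. t \<in> Q \<Longrightarrow> i < M \<Longrightarrow> \<kappa> * \<bar>t i\<bar> \<le> 1"
    and sep: "\<And>t s. t \<in> Q \<Longrightarrow> s \<in> Q \<Longrightarrow> t \<noteq> s \<Longrightarrow> a \<le> dist2 M t s"
    and small: "8 * expected_max M Q \<le> \<kappa> * a\<^sup>2"
  shows "real (card Q) \<le> 4 * exp (\<kappa>\<^sup>2 * R\<^sup>2)"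
proof -
  define p where "p = (\<lambda>t \<epsilon> :: nat \<Rightarrow> real. \<Prod>i<M. 1 + (\<kappa> * t i) * \<epsilon> i)"
  define s where "s = (\<lambda>t \<epsilon>. ip M \<epsilon> t - \<kappa> * ip M t t / 2)"
  define B where "B = (\<lambda>t. {\<epsilon>. \<forall>k\<in>Q. k \<noteq> t \<longrightarrow> s k \<epsilon> < s t \<epsilon>})"
  define V where "V = exp (\<kappa>\<^sup>2 * R\<^sup>2)"
  have V: "V > 0" by (simp add: V_def)
  \<comment> \<open>The sup norm bound \<open>D\<close> keeps every factor nonnegative, so that
    \<open>p t\<close> is a density.\<close>
  have p_nonneg: "p t \<epsilon> \<ge> 0" if "t \<in> Q" "\<And>i. \<bar>\<epsilon> i\<bar> \<le> 1" for t \<epsilon>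
  proof -
    have "\<bar>(\<kappa> * t i) * \<epsilon> i\<bar> \<le> 1" if "i < M" for i
      using D[OF \<open>t \<in> Q\<close> that] \<open>\<bar>\<epsilon> i\<bar> \<le> 1\<close> kap
      by (auto simp: abs_mult intro!: mult_le_one)
    then show ?thesis
      unfolding p_def by (intro prod_nonneg) (auto simp: abs_le_iff, smt (verit))
  qed
  have p_1: "sign_exp M (p t) = 1" for t
    unfolding p_def by (subst sign_exp_prod) simp
  have p_2: "sign_exp M (\<lambda>\<epsilon>. (p t \<epsilon>)\<^sup>2) \<le> V" if "t \<in> Q" for t
  proof -
    have "sign_exp M (\<lambda>\<epsilon>. (p t \<epsilon>)\<^sup>2) = (\<Prod>i<M. 1 + (\<kappa> * t i)\<^sup>2)"
      unfolding p_def prod_power_distrib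
      by (subst sign_exp_prod[where h = "\<lambda>i v. (1 + \<kappa> * t i * v)\<^sup>2"]) (simp add: power2_eq_square algebra_simps add_divide_distrib)
    also have "\<dots> \<le> (\<Prod>i<M. exp ((\<kappa> * t i)\<^sup>2))"
      by (intro prod_mono) (auto intro: exp_ge_add_one_self)
    also have "\<dots> = exp (\<kappa>\<^sup>2 * (\<Sum>i<M. (t i)\<^sup>2))"
      by (simp add: exp_sum sum_distrib_left power_mult_distrib)
    also have "\<dots> \<le> V"
      unfolding V_def using R[OF that] by (auto intro: mult_left_mono)
    finally show ?thesis .
  qed
  have miss: "sign_exp M (\<lambda>\<epsilon>. p t \<epsilon> * indicator (- B t) \<epsilon>) \<le> 1 / 2" if t: "t \<in> Q" for t
  proof -
    define Q' where "Q' = (\<lambda>k i. k i - t i) ` Q"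
    have Q': "finite Q'" "Q' \<noteq> {}" using fin t by (auto simp: Q'_def)
    \<comment> \<open>Markov's inequality at the level \<kappa> * a^2 / 2, which the recentred
      supremum reaches whenever t is missed.\<close>
    define c where "c = 2 / (\<kappa> * a\<^sup>2)"
    have c: "c > 0" using kap a by (simp add: c_def)
    define shift where "shift = (\<lambda>\<epsilon> :: nat \<Rightarrow> real. \<lambda>i. if i < M then \<epsilon> i - \<kappa> * t i else 0)"
    have F_nonneg: "hmax M Q' x \<ge> 0" for x
    proof -
      have "(\<lambda>i. t i - t i) \<in> Q'"
        unfolding Q'_def using t by (rule imageI)
      from hmax_ge[OF Q'(1) this, of x M] show ?thesis
        by simp
    qed
    have miss_large: "1 \<le> c * hmax M Q' (shift \<epsilon>)" if "\<epsilon> \<notin> B t" for \<epsilon>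
    proof -
      obtain k where k: "k \<in> Q" "k \<noteq> t" "s t \<epsilon> \<le> s k \<epsilon>"
        using \<open>\<epsilon> \<notin> B t\<close> by (auto simp: B_def not_less)
      have "ip M (shift \<epsilon>) (\<lambda>i. k i - t i) = ip M (\<lambda>i. \<epsilon> i - \<kappa> * t i) (\<lambda>i. k i - t i)"
        by (intro ip_cong_left) (auto simp: shift_def)
      also have "\<dots> = s k \<epsilon> - s t \<epsilon> + \<kappa> * (dist2 M k t)\<^sup>2 / 2"
        unfolding s_def dist2_power2
        by (simp add: power2_eq_square algebra_simps sum.distrib sum_subtractf sum_distrib_left
            flip: sum_divide_distrib)
          (simp add: field_simps sum_distrib_left)
      also have "\<dots> \<ge> \<kappa> * a\<^sup>2 / 2"
        using k sep[of k t] t kap a by (auto intro!: add_increasing mult_left_mono power_mono)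
      finally have "\<kappa> * a\<^sup>2 / 2 \<le> ip M (shift \<epsilon>) (\<lambda>i. k i - t i)" .
      also have "\<dots> \<le> hmax M Q' (shift \<epsilon>)"
        using Q' k by (intro hmax_ge) (auto simp: Q'_def)
      finally have "c * (\<kappa> * a\<^sup>2 / 2) \<le> c * hmax M Q' (shift \<epsilon>)"
        using c by (intro mult_left_mono) auto
      then show ?thesis using kap a by (simp add: c_def)
    qed
    have "sign_exp M (\<lambda>\<epsilon>. p t \<epsilon> * indicator (- B t) \<epsilon>) \<le>
        sign_exp M (\<lambda>\<epsilon>. c * (p t \<epsilon> * hmax M Q' (shift \<epsilon>)))"
    proof (rule sign_exp_mono)
      fix \<epsilon> :: "nat \<Rightarrow> real" assume e: "\<And>i. \<bar>\<epsilon> i\<bar> \<le> 1"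
      have "p t \<epsilon> * indicator (- B t) \<epsilon> \<le> p t \<epsilon> * (c * hmax M Q' (shift \<epsilon>))"
        using miss_large[of \<epsilon>] c F_nonneg[of "shift \<epsilon>"]
        by (intro mult_left_mono p_nonneg[OF t e]) (auto simp: indicator_def)
      then show "p t \<epsilon> * indicator (- B t) \<epsilon> \<le> c * (p t \<epsilon> * hmax M Q' (shift \<epsilon>))"
        by (simp add: mult_ac)
    qed
    also have "\<dots> \<le> c * sign_exp M (\<lambda>\<epsilon>. hmax M Q' (\<lambda>i. if i < M then 2 * \<epsilon> i else 0))"
      using c unfolding p_def shift_def
      by (simp only: integral_mult_right_zero, intro mult_left_mono sign_exp_tilted_le cvx_hmax Q')
        (use D[OF t] kap in \<open>auto simp: abs_mult\<close>)
    also have "\<dots> \<le> c * sign_exp M (\<lambda>\<epsilon>. 2 * hmax M Q' \<epsilon>)"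
    proof (intro mult_left_mono sign_exp_mono hmax_le Q')
      fix \<epsilon> k assume "k \<in> Q'"
      then have "2 * ip M \<epsilon> k \<le> 2 * hmax M Q' \<epsilon>"
        using Q' by (intro mult_left_mono hmax_ge) auto
      then show "ip M (\<lambda>i. if i < M then 2 * \<epsilon> i else 0) k \<le> 2 * hmax M Q' \<epsilon>"
        by (simp add: sum_distrib_left mult_ac)
    qed (use c in auto)
    also have "\<dots> = 2 * c * expected_max M Q'"
      by (simp add: expected_max_hmax)
    also have "\<dots> = 2 * c * expected_max M Q"
      using fin t unfolding Q'_def by (subst expected_max_translate) auto
    also have "\<dots> \<le> 1 / 2"
      using small kap a by (simp add: c_def field_simps)
    finally show ?thesis .
  qed
  have hit: "1 / (4 * V) \<le> sign_exp M (indicator (B t))" if t: "t \<in> Q" for t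
  proof -
    have "p t = (\<lambda>\<epsilon>. p t \<epsilon> * indicator (- B t) \<epsilon> + p t \<epsilon> * indicator (B t) \<epsilon>)"
      by (auto simp: indicator_def)
    then have "sign_exp M (p t) = sign_exp M (\<lambda>\<epsilon>. p t \<epsilon> * indicator (- B t) \<epsilon> + p t \<epsilon> * indicator (B t) \<epsilon>)"
      by (rule arg_cong)
    also have "\<dots> = sign_exp M (\<lambda>\<epsilon>. p t \<epsilon> * indicator (- B t) \<epsilon>) + sign_exp M (\<lambda>\<epsilon>. p t \<epsilon> * indicator (B t) \<epsilon>)"
      by (intro Bochner_Integration.integral_add integrable_signs)
    finally have "1 = sign_exp M (\<lambda>\<epsilon>. p t \<epsilon> * indicator (- B t) \<epsilon>) + sign_exp M (\<lambda>\<epsilon>. p t \<epsilon> * indicator (B t) \<epsilon>)"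
      by (simp only: p_1)
    with miss[OF t] have "1 / 2 \<le> sign_exp M (\<lambda>\<epsilon>. p t \<epsilon> * indicator (B t) \<epsilon>)"
      by linarith
    also have "\<dots> \<le> sign_exp M (\<lambda>\<epsilon>. (p t \<epsilon>)\<^sup>2 / (4 * V) + V * indicator (B t) \<epsilon>)"
    proof (rule sign_exp_mono)
      fix \<epsilon>
      \<comment> \<open>AM-GM in place of Cauchy-Schwarz, weighted so that the second moment uses up
        only 1/4 of the mass 1/2.\<close>
      have "0 \<le> (p t \<epsilon> - 2 * V)\<^sup>2 / (4 * V)" using V by simp
      then have "p t \<epsilon> \<le> (p t \<epsilon>)\<^sup>2 / (4 * V) + V"
        using V by (simp add: field_simps power2_eq_square)
      then show "p t \<epsilon> * indicator (B t) \<epsilon> \<le> (p t \<epsilon>)\<^sup>2 / (4 * V) + V * indicator (B t) \<epsilon>"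
        using V by (auto simp: indicator_def)
    qed
    also have "\<dots> = sign_exp M (\<lambda>\<epsilon>. (p t \<epsilon>)\<^sup>2) / (4 * V) + V * sign_exp M (indicator (B t))"
      by simp
    also have "\<dots> \<le> V / (4 * V) + V * sign_exp M (indicator (B t))"
      using p_2[OF t] V by (intro add_right_mono divide_right_mono) auto
    finally show ?thesis using V by (simp add: field_simps)
  qed
  have "real (card Q) / (4 * V) = (\<Sum>t\<in>Q. 1 / (4 * V))"
    by simp
  also have "\<dots> \<le> (\<Sum>t\<in>Q. sign_exp M (indicator (B t)))"
    by (intro sum_mono hit)
  also have "\<dots> = sign_exp M (\<lambda>\<epsilon>. \<Sum>t\<in>Q. indicator (B t) \<epsilon>)"
    by (rule Bochner_Integration.integral_sum[symmetric]) (rule integrable_signs)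
  also have "\<dots> \<le> sign_exp M (\<lambda>_. 1)"
  proof (rule sign_exp_mono)
    fix \<epsilon>
    have "t = t'" if "t \<in> Q" "t' \<in> Q" "\<epsilon> \<in> B t" "\<epsilon> \<in> B t'" for t t'
      using that by (force simp: B_def)
    then have "card (Q \<inter> {t. \<epsilon> \<in> B t}) \<le> Suc 0"
      using fin by (subst card_le_Suc0_iff_eq) auto
    moreover have "(\<Sum>t\<in>Q. indicator (B t) \<epsilon>) = real (card (Q \<inter> {t. \<epsilon> \<in> B t}))"
      using fin by (simp add: indicator_def sum.If_cases)
    ultimately show "(\<Sum>t\<in>Q. indicator (B t) \<epsilon>) \<le> (1 :: real)"
      by simp
  qed
  finally show ?thesis using V by (simp add: V_def field_simps)
qed

section \<open>Concentration\<close>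

text \<open>The one-dimensional core of the inequality on the cube: v is the log ratio of the means
  of exp (-f) on two opposite facets, \<theta> the weight that the lighter facet gives to the
  heavier one, and \<theta>^2 / 4 the quadratic cost of doing so. The choice is \<theta> = min v
  1.\<close>

lemma two_point_inequality:
  fixes v :: real
  assumes "v \<ge> 0"
  shows "\<exists>\<theta>. 0 \<le> \<theta> \<and> \<theta> \<le> 1 \<and> (1 + exp (-v)) * (1 + exp (v - \<theta> * v + \<theta>\<^sup>2 / 4)) \<le> 4"
proof (cases "v \<le> 1")
  case True
  define w where "w = 1 + 3 * v\<^sup>2 / 4"
  have w: "w \<ge> 1" by (simp add: w_def)
  have e1: "exp (-v) \<le> 1 - v + v\<^sup>2 / 2"
  proof -
    have "1 + v + v\<^sup>2 / 2 \<le> exp v"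
      using assms by (rule exp_lower_Taylor_quadratic)
    then have "1 \<le> exp (-v) * exp v" "exp (-v) * (1 + v + v\<^sup>2 / 2) \<le> 1"
      by (auto simp: exp_minus field_simps)
    moreover have "1 \<le> (1 - v + v\<^sup>2 / 2) * (1 + v + v\<^sup>2 / 2)"
    proof -
      have "(1 - v + v\<^sup>2 / 2) * (1 + v + v\<^sup>2 / 2) = 1 + v ^ 4 / 4"
        by (simp add: field_simps power2_eq_square eval_nat_numeral)
      then show ?thesis by simp
    qed
    moreover have "1 + v + v\<^sup>2 / 2 > 0"
      using assms by (simp add: add_pos_nonneg)
    ultimately show ?thesis
      by (meson mult_right_le_imp_le order_trans)
  qed
  have e2: "exp v \<le> 1 + v + v\<^sup>2"
    using exp_bound assms True by simp
  have e3: "exp (- (3 * v\<^sup>2 / 4)) \<le> 1 / w"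
    unfolding exp_minus inverse_eq_divide
    using exp_ge_add_one_self[of "3 * v\<^sup>2 / 4"] w
    by (intro divide_left_mono mult_pos_pos) (simp add: w_def, linarith, simp_all)
  have "(1 + exp (-v)) * (1 + exp (v - v * v + v\<^sup>2 / 4)) =
      1 + exp (-v) + exp (- (3 * v\<^sup>2 / 4)) * (1 + exp v)"
    by (simp add: algebra_simps power2_eq_square flip: exp_add)
  also have "\<dots> \<le> 1 + (1 - v + v\<^sup>2 / 2) + 1 / w * (1 + (1 + v + v\<^sup>2))"
    using w by (intro add_mono mult_mono e1 e2 e3) (auto intro: add_nonneg_nonneg)
  also have "\<dots> \<le> 4"
  proof -
    have "v ^ 4 \<le> v ^ 3"
      using assms True by (intro power_decreasing) auto
    moreover have "v ^ 3 \<ge> 0" using assms by simp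
    moreover have "(2 + v - v\<^sup>2 / 2) * w = 2 + v + v\<^sup>2 + 3 * v ^ 3 / 4 - 3 * v ^ 4 / 8"
      by (simp add: w_def field_simps power2_eq_square eval_nat_numeral)
    ultimately have "2 + v + v\<^sup>2 \<le> (2 + v - v\<^sup>2 / 2) * w"
      by linarith
    then have "(2 + v + v\<^sup>2) / w \<le> 2 + v - v\<^sup>2 / 2"
      using w by (simp add: divide_le_eq)
    moreover have "1 / w * (1 + (1 + v + v\<^sup>2)) = (2 + v + v\<^sup>2) / w"
      by simp
    ultimately show ?thesis by linarith
  qed
  finally show ?thesis
    using assms True by (intro exI[of _ v]) auto
next
  case False
  have "exp (-v) \<le> 1 / 2"
  proof -
    have "2 \<le> exp v"
      using exp_ge_add_one_self[of v] False by linarith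
    then show ?thesis by (simp add: exp_minus field_simps)
  qed
  moreover have "exp (1 / 4 :: real) \<le> 5 / 3"
    using exp_bound[of "1 / 4 :: real"] by (simp add: power2_eq_square)
  ultimately have "(1 + exp (-v)) * (1 + exp (1 / 4)) \<le> (1 + 1 / 2) * (1 + 5 / 3)"
    by (intro mult_mono add_mono) auto
  then show ?thesis
    by (intro exI[of _ 1]) simp
qed

lemma exp_convex_comb:
  fixes x y \<theta> :: real
  assumes "0 \<le> \<theta>" "\<theta> \<le> 1"
  shows "exp ((1 - \<theta>) * x + \<theta> * y) \<le> (1 - \<theta>) * exp x + \<theta> * exp y"
  using convex_onD[OF exp_convex, of \<theta> x y] assms by simp

text \<open>Hoelder's inequality with exponents 1 / (1 - \<theta>) and 1 / \<theta>: normalize both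
  exponential moments, then use the convexity of exp pointwise.\<close>

lemma sign_exp_exp_convex_comb:
  assumes \<theta>: "0 \<le> \<theta>" "\<theta> \<le> 1"
    and U: "sign_exp M (\<lambda>\<epsilon>. exp (U \<epsilon>)) \<le> exp (- \<alpha>)"
    and V: "sign_exp M (\<lambda>\<epsilon>. exp (V \<epsilon>)) \<le> exp (- \<beta>)"
  shows "sign_exp M (\<lambda>\<epsilon>. exp ((1 - \<theta>) * U \<epsilon> + \<theta> * V \<epsilon> + k)) \<le>
    exp (- (1 - \<theta>) * \<alpha> - \<theta> * \<beta> + k)"
proof -
  let ?m = "exp (- (1 - \<theta>) * \<alpha> - \<theta> * \<beta> + k)"
  have "sign_exp M (\<lambda>\<epsilon>. exp ((1 - \<theta>) * U \<epsilon> + \<theta> * V \<epsilon> + k)) =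
      sign_exp M (\<lambda>\<epsilon>. ?m * exp ((1 - \<theta>) * (U \<epsilon> + \<alpha>) + \<theta> * (V \<epsilon> + \<beta>)))"
    by (intro arg_cong[where f = "sign_exp M"] ext) (simp add: algebra_simps flip: exp_add)
  also have "\<dots> \<le> sign_exp M (\<lambda>\<epsilon>. ?m * ((1 - \<theta>) * exp (U \<epsilon> + \<alpha>) + \<theta> * exp (V \<epsilon> + \<beta>)))"
    using \<theta> by (intro sign_exp_mono mult_left_mono exp_convex_comb) auto
  also have "\<dots> = ?m * ((1 - \<theta>) * (exp \<alpha> * sign_exp M (\<lambda>\<epsilon>. exp (U \<epsilon>))) +
      \<theta> * (exp \<beta> * sign_exp M (\<lambda>\<epsilon>. exp (V \<epsilon>))))"
    by (simp add: exp_add mult_ac)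
  also have "\<dots> \<le> ?m * ((1 - \<theta>) * (exp \<alpha> * exp (- \<alpha>)) + \<theta> * (exp \<beta> * exp (- \<beta>)))"
    using \<theta> U V by (intro mult_left_mono add_mono) auto
  also have "\<dots> = ?m"
    by (simp flip: exp_add)
  finally show ?thesis .
qed

text \<open>The two infima are approximated at different points y and z, as the two facets of the
  cube have different near-minimizers.\<close>

lemma le_convex_comb_INF:
  fixes F1 F2 :: "'a \<Rightarrow> real"
  assumes \<theta>: "0 \<le> \<theta>" "\<theta> \<le> 1" and "X \<noteq> {}"
    and le: "\<And>y z. y \<in> X \<Longrightarrow> z \<in> X \<Longrightarrow> G \<le> (1 - \<theta>) * F1 y + \<theta> * F2 z + k"
  shows "G \<le> (1 - \<theta>) * (INF y\<in>X. F1 y) + \<theta> * (INF y\<in>X. F2 y) + k"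
proof (rule field_le_epsilon)
  fix e :: real assume e: "e > 0"
  have near: "\<exists>y\<in>X. F y \<le> (INF y\<in>X. F y) + e" for F :: "'a \<Rightarrow> real"
  proof (rule ccontr)
    assume *: "\<not> ?thesis"
    then have "(INF y\<in>X. F y) + e \<le> (INF y\<in>X. F y)"
      using \<open>X \<noteq> {}\<close> by (intro cINF_greatest) (auto simp: not_le intro: less_imp_le)
    with e show False by simp
  qed
  obtain y z where yz: "y \<in> X" "z \<in> X" "F1 y \<le> (INF y\<in>X. F1 y) + e" "F2 z \<le> (INF y\<in>X. F2 y) + e"
    using near[of F1] near[of F2] by blast
  have "G \<le> (1 - \<theta>) * F1 y + \<theta> * F2 z + k"
    using le yz by blast
  also have "\<dots> \<le> (1 - \<theta>) * ((INF y\<in>X. F1 y) + e) + \<theta> * ((INF y\<in>X. F2 y) + e) + k"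
    using yz \<theta> by (intro add_mono mult_left_mono) auto
  also have "\<dots> = (1 - \<theta>) * (INF y\<in>X. F1 y) + \<theta> * (INF y\<in>X. F2 y) + k + e"
    by (simp add: algebra_simps)
  finally show "G \<le> (1 - \<theta>) * (INF y\<in>X. F1 y) + \<theta> * (INF y\<in>X. F2 y) + k + e" .
qed

text \<open>Maurey's convex property \<open>(\<tau>)\<close> for the uniform measure on the discrete cube.\<close>
lemma convex_infimum_convolution:
  fixes f g :: "(nat \<Rightarrow> real) \<Rightarrow> real"
  assumes "cvx f"
    and "\<And>y. (\<And>i. \<bar>y i\<bar> \<le> 1) \<Longrightarrow> c \<le> f y"
    and "\<And>x y. (\<And>i. \<bar>x i\<bar> \<le> 1) \<Longrightarrow> (\<And>i. \<bar>y i\<bar> \<le> 1) \<Longrightarrow>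
      g x \<le> f y + (\<Sum>i<M. (x i - y i)\<^sup>2) / 16"
  shows "sign_exp M (\<lambda>\<epsilon>. exp (g \<epsilon>)) * sign_exp M (\<lambda>\<epsilon>. exp (- f \<epsilon>)) \<le> 1"
  using assms
proof (induction M arbitrary: f g)
  case 0
  from "0.prems"(3)[of "\<lambda>_. 0" "\<lambda>_. 0"] show ?case
    by (simp add: sign_exp_0 flip: exp_add)
next
  case (Suc M)
  define box :: "(nat \<Rightarrow> real) set" where "box = {y. \<forall>i. \<bar>y i\<bar> \<le> 1}"
  have box_ne: "box \<noteq> {}" by (auto simp: box_def intro!: exI[of _ "\<lambda>_. 0"])
  define d where "d = (\<lambda>x y :: nat \<Rightarrow> real. (\<Sum>i<M. (x i - y i)\<^sup>2) / 16)"
  have d_nonneg: "d x y \<ge> 0" for x y by (simp add: d_def sum_nonneg)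
  \<comment> \<open>The infimum convolution in the first M coordinates, for f restricted to the
    facet with last coordinate s. The lower bound c makes it a genuine infimum.\<close>
  define Q where "Q = (\<lambda>s x. INF y\<in>box. f (y(M := s)) + d x y)"
  define A where "A = (\<lambda>s. sign_exp M (\<lambda>\<epsilon>. exp (- f (\<epsilon>(M := s)))))"
  define G where "G = (\<lambda>s. sign_exp M (\<lambda>\<epsilon>. exp (g (\<epsilon>(M := s)))))"
  have lower: "c \<le> f (y(M := s)) + d x y" if "y \<in> box" "\<bar>s\<bar> \<le> 1" for x y s
  proof -
    have "c \<le> f (y(M := s))"
      using that by (intro Suc.prems(2)) (auto simp: box_def)
    with d_nonneg[of x y] show ?thesis by linarith
  qed
  have bdd: "bdd_below ((\<lambda>y. f (y(M := s)) + d x y) ` box)" if "\<bar>s\<bar> \<le> 1" for s x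
    using lower that by (auto intro!: bdd_belowI[of _ c])
  have A_pos: "A s > 0" for s
  proof -
    have "exp (sign_exp M (\<lambda>\<epsilon>. - f (\<epsilon>(M := s)))) \<le> A s"
      unfolding A_def by (rule sign_exp_exp_ge)
    then show ?thesis
      by (meson exp_gt_zero less_le_trans)
  qed
  have Q_le: "sign_exp M (\<lambda>\<epsilon>. exp (Q s \<epsilon>)) \<le> exp (- ln (A s))" if s: "\<bar>s\<bar> \<le> 1" for s
  proof -
    have "sign_exp M (\<lambda>\<epsilon>. exp (Q s \<epsilon>)) * A s \<le> 1"
      unfolding A_def
    proof (rule Suc.IH[of "\<lambda>x. f (x(M := s))"])
      fix x y :: "nat \<Rightarrow> real"
      show "c \<le> f (y(M := s))" if "\<And>i. \<bar>y i\<bar> \<le> 1"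
        by (rule Suc.prems(2)) (use that s in auto)
      show "Q s x \<le> f (y(M := s)) + (\<Sum>i<M. (x i - y i)\<^sup>2) / 16" if "\<And>i. \<bar>y i\<bar> \<le> 1"
        using cINF_lower[OF bdd[OF s], of y x] that by (simp add: box_def Q_def d_def)
    qed (rule cvx_fun_upd[OF Suc.prems(1)])
    then show ?thesis
      using A_pos[of s] by (simp add: exp_minus field_simps)
  qed
  have g_le: "g (x(M := s)) \<le> (1 - \<theta>) * Q s x + \<theta> * Q (-s) x + \<theta>\<^sup>2 / 4"
    if x: "\<And>i. \<bar>x i\<bar> \<le> 1" and s: "s \<in> {1, -1}" and \<theta>: "0 \<le> \<theta>" "\<theta> \<le> 1" for x s \<theta>
    unfolding Q_def
  proof (rule le_convex_comb_INF[OF \<theta> box_ne])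
    fix y1 y2 assume y: "y1 \<in> box" "y2 \<in> box"
    \<comment> \<open>The competitor mixes points taken from opposite facets. Its last coordinate is
      (1 - 2 * \<theta>) * s, at distance 2 * \<theta> from s, whence the cost 4 * \<theta>^2 /
      16.\<close>
    define y where "y = (\<lambda>i. (1 - \<theta>) * (y1(M := s)) i + (1 - (1 - \<theta>)) * (y2(M := -s)) i)"
    have "\<bar>y i\<bar> \<le> 1" for i
    proof -
      have "\<bar>(y1(M := s)) i\<bar> \<le> 1" "\<bar>(y2(M := -s)) i\<bar> \<le> 1"
        using y s by (auto simp: box_def)
      then have "\<bar>y i\<bar> \<le> (1 - \<theta>) * 1 + (1 - (1 - \<theta>)) * 1"
        unfolding y_def using \<theta>
        by (intro order_trans[OF abs_triangle_ineq] add_mono) (auto simp: abs_mult intro: mult_left_le)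
      then show ?thesis by simp
    qed
    then have "g (x(M := s)) \<le> f y + (\<Sum>i<Suc M. ((x(M := s)) i - y i)\<^sup>2) / 16"
      using x s by (intro Suc.prems(3)) auto
    also have "(\<Sum>i<Suc M. ((x(M := s)) i - y i)\<^sup>2) = (\<Sum>i<M. (x i - y i)\<^sup>2) + 4 * \<theta>\<^sup>2"
      using s by (auto simp: y_def power2_eq_square algebra_simps)
    also have "f y \<le> (1 - \<theta>) * f (y1(M := s)) + (1 - (1 - \<theta>)) * f (y2(M := -s))"
      unfolding y_def using \<theta> by (intro cvxD[OF Suc.prems(1)]) auto
    also have "(\<Sum>i<M. (x i - y i)\<^sup>2) \<le> (\<Sum>i<M. (1 - \<theta>) * (x i - y1 i)\<^sup>2 + \<theta> * (x i - y2 i)\<^sup>2)"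
    proof (rule sum_mono)
      fix i assume "i \<in> {..<M}"
      then have "(1 - \<theta>) * (x i - y1 i)\<^sup>2 + \<theta> * (x i - y2 i)\<^sup>2 - (x i - y i)\<^sup>2 =
          \<theta> * (1 - \<theta>) * (y1 i - y2 i)\<^sup>2"
        by (simp add: y_def power2_eq_square algebra_simps)
      moreover have "\<theta> * (1 - \<theta>) * (y1 i - y2 i)\<^sup>2 \<ge> 0"
        using \<theta> by simp
      ultimately show "(x i - y i)\<^sup>2 \<le> (1 - \<theta>) * (x i - y1 i)\<^sup>2 + \<theta> * (x i - y2 i)\<^sup>2"
        by linarith
    qed
    also have "\<dots> = 16 * ((1 - \<theta>) * d x y1 + \<theta> * d x y2)"
      by (simp add: d_def sum.distrib flip: sum_distrib_left)
    finally show "g (x(M := s)) \<le> (1 - \<theta>) * (f (y1(M := s)) + d x y1) +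
        \<theta> * (f (y2(M := -s)) + d x y2) + \<theta>\<^sup>2 / 4"
      by (simp add: algebra_simps add_divide_distrib diff_divide_distrib del: fun_upd_apply)
  qed
  have G_le: "G s \<le> exp (- (1 - \<theta>) * ln (A s) - \<theta> * ln (A (-s)) + \<theta>\<^sup>2 / 4)"
    if s: "s \<in> {1, -1}" and \<theta>: "0 \<le> \<theta>" "\<theta> \<le> 1" for s \<theta>
  proof -
    have "G s \<le> sign_exp M (\<lambda>\<epsilon>. exp ((1 - \<theta>) * Q s \<epsilon> + \<theta> * Q (-s) \<epsilon> + \<theta>\<^sup>2 / 4))"
      unfolding G_def using g_le[OF _ s \<theta>] by (intro sign_exp_mono) simp
    also have "\<dots> \<le> exp (- (1 - \<theta>) * ln (A s) - \<theta> * ln (A (-s)) + \<theta>\<^sup>2 / 4)"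
      using s by (intro sign_exp_exp_convex_comb \<theta> Q_le) auto
    finally show ?thesis .
  qed
  have main: "(G s + G (-s)) * (A s + A (-s)) \<le> 4" if s: "s \<in> {1, -1}" and le: "A (-s) \<le> A s" for s
  proof -
    define v where "v = ln (A s) - ln (A (-s))"
    have "v \<ge> 0" using le A_pos by (simp add: v_def)
    then obtain \<theta> where \<theta>: "0 \<le> \<theta>" "\<theta> \<le> 1"
      and le4: "(1 + exp (-v)) * (1 + exp (v - \<theta> * v + \<theta>\<^sup>2 / 4)) \<le> 4"
      using two_point_inequality by blast
    \<comment> \<open>The heavier facet uses weight 0; only the lighter one borrows from the other,
      with weight \<theta>.\<close>
    have "G s + G (-s) \<le> exp (- ln (A s)) + exp (- (1 - \<theta>) * ln (A (-s)) - \<theta> * ln (A s) + \<theta>\<^sup>2 / 4)"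
      using G_le[OF s, of 0] G_le[of "-s" \<theta>] s \<theta> by auto
    also have "\<dots> = exp (- ln (A s)) * (1 + exp (v - \<theta> * v + \<theta>\<^sup>2 / 4))"
      by (simp add: v_def algebra_simps flip: exp_add)
    finally have "(G s + G (-s)) * (A s + A (-s)) \<le>
        (exp (- ln (A s)) * (1 + exp (v - \<theta> * v + \<theta>\<^sup>2 / 4))) * (A s + A (-s))"
      using A_pos[of s] A_pos[of "-s"] by (intro mult_right_mono) auto
    also have "\<dots> = (1 + exp (-v)) * (1 + exp (v - \<theta> * v + \<theta>\<^sup>2 / 4))"
    proof -
      have "A s + A (-s) = exp (ln (A s)) * (1 + exp (-v))"
        using A_pos[of s] A_pos[of "-s"] by (simp add: v_def exp_diff distrib_left)
      then show ?thesis
        using A_pos[of s] by (simp add: exp_minus field_simps)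
    qed
    also note le4
    finally show ?thesis .
  qed
  have "(G 1 + G (-1)) * (A 1 + A (-1)) \<le> 4"
    using main[of 1] main[of "-1"] by (cases "A (-1) \<le> A 1") (auto simp: add.commute)
  then show ?case
    by (simp add: sign_exp_Suc G_def A_def)
qed

text \<open>The support function is convex and r-Lipschitz. For points at distance l, \<kappa> * l *
  r is at most l^2 / 16 + 4 * \<kappa>^2 * r^2, so with f = \<kappa> * \<open>hmax M S\<close> the
  function g = f - 4 * \<kappa>^2 * r^2 is admissible in the convex property. Jensen's inequality
  then replaces the first factor by the exponential of the mean.\<close>

lemma hmax_lower_tail:
  assumes S: "finite S" "S \<noteq> {}" and r: "\<And>t. t \<in> S \<Longrightarrow> (\<Sum>i<M. (t i)\<^sup>2) \<le> r\<^sup>2"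
    and "r \<ge> 0" "\<kappa> \<ge> 0"
  shows "sign_exp M (\<lambda>\<epsilon>. exp (\<kappa> * (expected_max M S - hmax M S \<epsilon>))) \<le> exp (4 * \<kappa>\<^sup>2 * r\<^sup>2)"
proof -
  define f where "f = (\<lambda>x. \<kappa> * hmax M S x)"
  define k where "k = 4 * \<kappa>\<^sup>2 * r\<^sup>2"
  obtain t0 where t0: "t0 \<in> S" using S by blast
  have "cvx f"
    unfolding cvx_def f_def
  proof (intro allI impI)
    fix x y :: "nat \<Rightarrow> real" and s :: real assume "0 \<le> s" "s \<le> 1"
    from mult_left_mono[OF cvxD[OF cvx_hmax[OF S] this, of M x y] \<open>\<kappa> \<ge> 0\<close>]
    show "\<kappa> * hmax M S (\<lambda>i. s * x i + (1 - s) * y i) \<le>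
        s * (\<kappa> * hmax M S x) + (1 - s) * (\<kappa> * hmax M S y)"
      by (simp only: distrib_left mult.left_commute)
  qed
  moreover have "\<kappa> * (- (\<Sum>i<M. \<bar>t0 i\<bar>)) \<le> f y" if "\<And>i. \<bar>y i\<bar> \<le> 1" for y
  proof -
    have "- (\<Sum>i<M. \<bar>t0 i\<bar>) \<le> ip M y t0"
      unfolding sum_negf[symmetric]
    proof (rule sum_mono)
      fix i
      have "\<bar>y i * t0 i\<bar> \<le> 1 * \<bar>t0 i\<bar>"
        unfolding abs_mult using that by (intro mult_right_mono) auto
      then show "- \<bar>t0 i\<bar> \<le> y i * t0 i" by linarith
    qed
    also have "\<dots> \<le> hmax M S y" by (rule hmax_ge[OF S(1) t0])
    finally show ?thesis
      unfolding f_def using \<open>\<kappa> \<ge> 0\<close> by (rule mult_left_mono)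
  qed
  moreover have "f x - k \<le> f y + (\<Sum>i<M. (x i - y i)\<^sup>2) / 16" for x y
  proof -
    define l where "l = dist2 M x y"
    have "hmax M S x \<le> hmax M S y + l * r"
    proof (rule hmax_le[OF S])
      fix t assume t: "t \<in> S"
      have "ip M x t - ip M y t = ip M t x - ip M t y"
        by (simp add: mult.commute)
      also have "\<dots> \<le> L2_set t {..<M} * l"
        unfolding l_def by (rule ip_diff_le_dist2)
      also have "\<dots> \<le> r * l"
        using r[OF t] \<open>r \<ge> 0\<close> unfolding l_def L2_set_def
        by (intro mult_right_mono real_le_lsqrt) (auto simp: sum_nonneg dist2_def)
      finally show "ip M x t \<le> hmax M S y + l * r"
        using hmax_ge[OF S(1) t, of y M] by (simp add: mult.commute)
    qed
    then have "f x \<le> \<kappa> * (hmax M S y + l * r)"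
      unfolding f_def using \<open>\<kappa> \<ge> 0\<close> by (rule mult_left_mono)
    moreover have "0 \<le> (l / 4 - 2 * \<kappa> * r)\<^sup>2" by simp
    ultimately have "f x \<le> f y + k + l\<^sup>2 / 16"
      by (simp add: f_def k_def power2_eq_square algebra_simps)
    then show ?thesis
      by (simp add: l_def dist2_power2)
  qed
  ultimately have "sign_exp M (\<lambda>\<epsilon>. exp (f \<epsilon> - k)) * sign_exp M (\<lambda>\<epsilon>. exp (- f \<epsilon>)) \<le> 1"
    by (rule convex_infimum_convolution)
  moreover have "exp (\<kappa> * expected_max M S - k) \<le> sign_exp M (\<lambda>\<epsilon>. exp (f \<epsilon> - k))"
    using sign_exp_exp_ge[of M "\<lambda>\<epsilon>. f \<epsilon> - k"] by (simp add: f_def expected_max_hmax)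
  moreover have "sign_exp M (\<lambda>\<epsilon>. exp (- f \<epsilon>)) \<ge> 0"
    by (intro integral_nonneg_AE) auto
  ultimately have "exp (\<kappa> * expected_max M S - k) * sign_exp M (\<lambda>\<epsilon>. exp (- f \<epsilon>)) \<le> 1"
    by (meson mult_right_mono order_trans)
  then have "exp (\<kappa> * expected_max M S) * sign_exp M (\<lambda>\<epsilon>. exp (- f \<epsilon>)) \<le> exp k"
    by (simp add: exp_diff field_simps)
  then show ?thesis
    by (simp add: f_def k_def right_diff_distrib exp_diff exp_minus divide_inverse)
qed

text \<open>The supremum over \<open>H t\<close> is at least the value at t plus h minus a random
  shortfall. Sudakov minoration makes the largest value at the separated points big in mean, and
  concentration keeps the largest shortfall of order u * r.\<close>

lemma expected_max_growth:
  fixes H :: "(nat \<Rightarrow> real) \<Rightarrow> (nat \<Rightarrow> real) set"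
  assumes fin: "finite Q" and card: "real (card Q) > 4 * exp (u\<^sup>2)"
    and u: "u \<ge> 1" and r: "r > 0" and a: "a > 0" and R: "R > 0"
    and diam: "\<And>t s. t \<in> Q \<Longrightarrow> s \<in> Q \<Longrightarrow> dist2 M t s \<le> R"
    and sup_diam: "\<And>t s i. t \<in> Q \<Longrightarrow> s \<in> Q \<Longrightarrow> i < M \<Longrightarrow> \<bar>t i - s i\<bar> \<le> R / u"
    and sep: "\<And>t s. t \<in> Q \<Longrightarrow> s \<in> Q \<Longrightarrow> t \<noteq> s \<Longrightarrow> a \<le> dist2 M t s"
    and H: "\<And>t. t \<in> Q \<Longrightarrow> finite (H t)" "\<And>t. t \<in> Q \<Longrightarrow> H t \<noteq> {}"
    and near: "\<And>t s. t \<in> Q \<Longrightarrow> s \<in> H t \<Longrightarrow> dist2 M t s \<le> r"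
    and h: "\<And>t. t \<in> Q \<Longrightarrow> h \<le> expected_max M (H t)"
  shows "h + u * a\<^sup>2 / (8 * R) - 8 * u * r \<le> expected_max M (\<Union>t\<in>Q. H t)"
proof -
  \<comment> \<open>Just enough points for Sudakov are kept: the union bound over the shortfalls
    needs an upper bound on their number.\<close>
  define m where "m = nat \<lfloor>4 * exp (u\<^sup>2)\<rfloor> + 1"
  have m: "4 * exp (u\<^sup>2) < m" "m \<le> 4 * exp (u\<^sup>2) + 1"
    unfolding m_def by (simp_all add: of_nat_nat) linarith+
  have "m \<le> card Q"
  proof -
    have "of_int \<lfloor>4 * exp (u\<^sup>2)\<rfloor> < real (card Q)"
      using card of_int_floor_le[of "4 * exp (u\<^sup>2)"] by linarith
    then have "\<lfloor>4 * exp (u\<^sup>2)\<rfloor> < int (card Q)"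
      by linarith
    then show ?thesis
      by (simp add: m_def nat_less_iff Suc_le_eq)
  qed
  then obtain P where P: "P \<subseteq> Q" "card P = m" "finite P"
    using fin by (meson obtain_subset_with_card_n)
  have "P \<noteq> {}" using P by (auto simp: m_def)
  then obtain t0 where t0: "t0 \<in> P" by blast
  have PQ: "t \<in> Q" if "t \<in> P" for t using P that by blast
  \<comment> \<open>Recentring at \<open>t0\<close> turns the diameter bounds into bounds on the
    points themselves, as Sudakov with \<kappa> = u / R requires.\<close>
  define tr where "tr = (\<lambda>t i. t i - t0 i :: real)"
  have inj: "inj_on tr P"
    by (rule inj_onI) (auto simp: tr_def fun_eq_iff)
  have tr_dist: "dist2 M (tr t) (tr s) = dist2 M t s" for t s
    by (simp add: dist2_def tr_def)
  have sudakov: "u * a\<^sup>2 / (8 * R) \<le> expected_max M P"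
  proof (rule ccontr)
    assume "\<not> ?thesis"
    then have "8 * expected_max M P \<le> u / R * a\<^sup>2"
      using R by (simp add: field_simps)
    then have *: "8 * expected_max M (tr ` P) \<le> u / R * a\<^sup>2"
      using P \<open>P \<noteq> {}\<close> by (simp add: tr_def expected_max_translate)
    have "real (card (tr ` P)) \<le> 4 * exp ((u / R)\<^sup>2 * R\<^sup>2)"
    proof (rule local_sudakov[OF _ _ a _ _ _ *])
      show "finite (tr ` P)" "0 < u / R" using P u R by auto
      show "(\<Sum>i<M. (t i)\<^sup>2) \<le> R\<^sup>2" if "t \<in> tr ` P" for t
      proof -
        obtain s where s: "s \<in> P" "t = tr s" using \<open>t \<in> tr ` P\<close> by blast
        then have "(dist2 M s t0)\<^sup>2 \<le> R\<^sup>2"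
          using diam[of s t0] PQ t0 by (intro power_mono) (auto simp: dist2_def)
        then show ?thesis by (simp add: dist2_power2 s tr_def)
      qed
      show "u / R * \<bar>t i\<bar> \<le> 1" if "t \<in> tr ` P" "i < M" for t i
        using that sup_diam[of _ t0 i] PQ t0 u R by (auto simp: tr_def field_simps)
      show "a \<le> dist2 M t s" if "t \<in> tr ` P" "s \<in> tr ` P" "t \<noteq> s" for t s
      proof -
        obtain t' s' where "t' \<in> P" "s' \<in> P" "t = tr t'" "s = tr s'"
          using \<open>t \<in> tr ` P\<close> \<open>s \<in> tr ` P\<close> by blast
        with \<open>t \<noteq> s\<close> show ?thesis
          using sep[of t' s'] PQ by (auto simp: tr_dist)
      qed
    qed
    then show False
      using m P R by (simp add: card_image[OF inj] power_divide)
  qed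
  \<comment> \<open>Subtracting t leaves vectors of norm at most r, so the shortfall fluctuates on
    the scale r instead of R.\<close>
  define H' where "H' = (\<lambda>t. (\<lambda>s i. s i - t i) ` H t)"
  have H': "finite (H' t)" "H' t \<noteq> {}" if "t \<in> P" for t
    using that H PQ by (auto simp: H'_def)
  define Z where "Z = (\<lambda>t \<epsilon>. expected_max M (H' t) - hmax M (H' t) \<epsilon>)"
  define Y where "Y = (\<lambda>\<epsilon>. Max ((\<lambda>t. Z t \<epsilon>) ` P))"
  define U where "U = (\<Union>t\<in>P. H t)"
  have U: "finite U" "U \<noteq> {}" "U \<subseteq> (\<Union>t\<in>Q. H t)"
    using P \<open>P \<noteq> {}\<close> H PQ by (auto simp: U_def)
  have Z_le: "Z t \<epsilon> \<le> Y \<epsilon>" if "t \<in> P" for t \<epsilon>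
    unfolding Y_def using P that by (intro Max_ge) auto
  have "hmax M P \<epsilon> \<le> hmax M U \<epsilon> - h + Y \<epsilon>" for \<epsilon>
  proof (rule hmax_le[OF P(3) \<open>P \<noteq> {}\<close>])
    fix t assume t: "t \<in> P"
    then have "Z t \<epsilon> = expected_max M (H t) - (hmax M (H t) \<epsilon> - ip M \<epsilon> t)"
      using H PQ by (simp add: Z_def H'_def expected_max_translate hmax_translate)
    moreover have "hmax M (H t) \<epsilon> \<le> hmax M U \<epsilon>"
      using U t H PQ by (intro hmax_mono) (auto simp: U_def)
    ultimately show "ip M \<epsilon> t \<le> hmax M U \<epsilon> - h + Y \<epsilon>"
      using Z_le[OF t, of \<epsilon>] h[OF PQ[OF t]] by linarith
  qed
  then have "expected_max M P \<le> sign_exp M (\<lambda>\<epsilon>. hmax M U \<epsilon> - h + Y \<epsilon>)"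
    unfolding expected_max_hmax by (intro sign_exp_mono)
  also have "\<dots> = expected_max M U - h + sign_exp M Y"
    by (simp add: expected_max_hmax)
  finally have le1: "expected_max M P \<le> expected_max M U - h + sign_exp M Y" .
  have "sign_exp M Y \<le> 8 * u * r"
  proof -
    \<comment> \<open>With this choice m moments of size exp (4 * u^2) add up to at most exp (8 *
      u^2), and 8 * u^2 / \<kappa> = 8 * u * r.\<close>
    define \<kappa> where "\<kappa> = u / r"
    have \<kappa>: "\<kappa> > 0" using u r by (simp add: \<kappa>_def)
    have \<kappa>r: "\<kappa>\<^sup>2 * r\<^sup>2 = u\<^sup>2" using r by (simp add: \<kappa>_def power_divide)
    have u2: "u\<^sup>2 \<ge> 1" using u by (simp add: one_le_power)
    have "exp (\<kappa> * sign_exp M Y) \<le> sign_exp M (\<lambda>\<epsilon>. exp (\<kappa> * Y \<epsilon>))"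
      using sign_exp_exp_ge[of M "\<lambda>\<epsilon>. \<kappa> * Y \<epsilon>"] by simp
    also have "\<dots> \<le> sign_exp M (\<lambda>\<epsilon>. \<Sum>t\<in>P. exp (\<kappa> * Z t \<epsilon>))"
    proof (rule sign_exp_mono)
      fix \<epsilon>
      have "Y \<epsilon> \<in> (\<lambda>t. Z t \<epsilon>) ` P"
        unfolding Y_def using P \<open>P \<noteq> {}\<close> by (intro Max_in) auto
      then obtain t where "t \<in> P" "Y \<epsilon> = Z t \<epsilon>" by auto
      then show "exp (\<kappa> * Y \<epsilon>) \<le> (\<Sum>t\<in>P. exp (\<kappa> * Z t \<epsilon>))"
        using P by (auto intro!: member_le_sum[of t P "\<lambda>t. exp (\<kappa> * Z t \<epsilon>)"])
    qed
    also have "\<dots> = (\<Sum>t\<in>P. sign_exp M (\<lambda>\<epsilon>. exp (\<kappa> * Z t \<epsilon>)))"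
      by (intro Bochner_Integration.integral_sum integrable_signs)
    also have "\<dots> \<le> (\<Sum>t\<in>P. exp (4 * \<kappa>\<^sup>2 * r\<^sup>2))"
      unfolding Z_def
    proof (intro sum_mono hmax_lower_tail H')
      fix t s assume t: "t \<in> P" and "s \<in> H' t"
      then obtain s' where s': "s' \<in> H t" "s = (\<lambda>i. s' i - t i)" by (auto simp: H'_def)
      then have "(dist2 M t s')\<^sup>2 \<le> r\<^sup>2"
        using near PQ t by (intro power_mono) (auto simp: dist2_def)
      then show "(\<Sum>i<M. (s i)\<^sup>2) \<le> r\<^sup>2"
        by (simp add: dist2_power2 s' power2_commute)
    qed (use r \<kappa> in auto)
    also have "\<dots> = real m * exp (4 * u\<^sup>2)"
      using P \<kappa>r by (simp add: mult.assoc)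
    also have "\<dots> \<le> (exp (3 * u\<^sup>2) * exp (u\<^sup>2)) * exp (4 * u\<^sup>2)"
    proof (intro mult_right_mono)
      have e: "exp (u\<^sup>2) \<ge> 2" using exp_ge_add_one_self[of "u\<^sup>2"] u2 by linarith
      have "exp (3 * u\<^sup>2) = exp (u\<^sup>2) ^ 3" by (simp flip: exp_of_nat_mult)
      also have "\<dots> \<ge> 2 ^ 3" using e by (intro power_mono) auto
      finally have "8 * exp (u\<^sup>2) \<le> exp (3 * u\<^sup>2) * exp (u\<^sup>2)"
        by (intro mult_right_mono) auto
      then show "real m \<le> exp (3 * u\<^sup>2) * exp (u\<^sup>2)"
        using m e by linarith
    qed auto
    also have "\<dots> = exp (\<kappa> * (8 * u * r))"
      using r by (simp add: \<kappa>_def power2_eq_square flip: exp_add)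
    finally show ?thesis
      using \<kappa> by simp
  qed
  moreover have "expected_max M U \<le> expected_max M (\<Union>t\<in>Q. H t)"
    using U fin H by (intro expected_max_mono) auto
  ultimately show ?thesis
    using le1 sudakov by linarith
qed

section \<open>Khintchine's inequality for the first moment\<close>

lemma sign_exp_ip_power2: "sign_exp M (\<lambda>\<epsilon>. (ip M \<epsilon> t + v)\<^sup>2) = (\<Sum>i<M. (t i)\<^sup>2) + v\<^sup>2"
proof (induction M arbitrary: v)
  case (Suc M)
  show ?case
    unfolding sign_exp_Suc ip_fun_upd add.assoc Suc.IH
    by (simp add: power2_eq_square algebra_simps add_divide_distrib)
qed (simp add: sign_exp_0)

lemma sign_exp_ip_power4: "sign_exp M (\<lambda>\<epsilon>. (ip M \<epsilon> t) ^ 4) \<le> 3 * (\<Sum>i<M. (t i)\<^sup>2)\<^sup>2"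
proof (induction M)
  case (Suc M)
  let ?c = "t M" and ?V = "\<Sum>i<M. (t i)\<^sup>2"
  have "((ip M \<epsilon> t + 1 * ?c) ^ 4 + (ip M \<epsilon> t + -1 * ?c) ^ 4) / 2 =
      (ip M \<epsilon> t) ^ 4 + 6 * ?c\<^sup>2 * (ip M \<epsilon> t)\<^sup>2 + ?c ^ 4" for \<epsilon>
    by (simp add: eval_nat_numeral algebra_simps)
  then have "sign_exp (Suc M) (\<lambda>\<epsilon>. (ip (Suc M) \<epsilon> t) ^ 4) =
      sign_exp M (\<lambda>\<epsilon>. (ip M \<epsilon> t) ^ 4 + 6 * ?c\<^sup>2 * (ip M \<epsilon> t)\<^sup>2 + ?c ^ 4)"
    unfolding sign_exp_Suc ip_fun_upd
    by (subst Bochner_Integration.integral_add[symmetric]) (auto simp flip: integral_divide_zero)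
  also have "\<dots> = sign_exp M (\<lambda>\<epsilon>. (ip M \<epsilon> t) ^ 4) + 6 * ?c\<^sup>2 * ?V + ?c ^ 4"
    using sign_exp_ip_power2[of M t 0] by (simp add: Bochner_Integration.integral_add)
  also have "\<dots> \<le> 3 * ?V\<^sup>2 + 6 * ?c\<^sup>2 * ?V + 3 * ?c ^ 4"
  proof -
    have "0 \<le> ?c ^ 4" by simp
    with Suc.IH show ?thesis by linarith
  qed
  also have "\<dots> = 3 * (?V + ?c\<^sup>2)\<^sup>2"
    by (simp add: eval_nat_numeral algebra_simps)
  finally show ?case by simp
qed (simp add: sign_exp_0)

text \<open>Fourth moment method: y^2 - 4/27 * y^4 is at most y for nonnegative y, with contact at y
  = 3/2. The normalized sum has second moment 1 and fourth moment at most 3, which leaves 1 -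
  4/9.\<close>

lemma sign_exp_abs_ip_ge: "5 / 9 * L2_set t {..<M} \<le> sign_exp M (\<lambda>\<epsilon>. \<bar>ip M \<epsilon> t\<bar>)"
proof (cases "L2_set t {..<M} = 0")
  case True
  then show ?thesis by (simp add: integral_nonneg_AE)
next
  case False
  define l where "l = L2_set t {..<M}"
  have l: "l > 0" using False by (simp add: l_def less_le)
  have l2: "(\<Sum>i<M. (t i)\<^sup>2) = l\<^sup>2" by (simp add: l_def L2_set_def sum_nonneg)
  have pw: "x\<^sup>2 / l - 4 / 27 * (x ^ 4 / l ^ 3) \<le> \<bar>x\<bar>" for x
  proof -
    define y where "y = \<bar>x\<bar> / l"
    have x: "\<bar>x\<bar> = y * l" "y \<ge> 0" using l by (auto simp: y_def)
    have "0 \<le> 4 / 27 * y * l * ((y - 3 / 2)\<^sup>2 * (y + 3))" using x l by simp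
    also have "\<dots> = y * l - (y\<^sup>2 * l - 4 / 27 * (y ^ 4 * l))"
      by (simp add: eval_nat_numeral algebra_simps)
    finally have "y\<^sup>2 * l - 4 / 27 * (y ^ 4 * l) \<le> \<bar>x\<bar>" using x by simp
    moreover have "x\<^sup>2 / l = y\<^sup>2 * l" "x ^ 4 / l ^ 3 = y ^ 4 * l"
      using l by (auto simp: y_def power_divide eval_nat_numeral field_simps)
    ultimately show ?thesis by simp
  qed
  have "5 / 9 * l = l\<^sup>2 / l - 4 / 27 * (3 * (l\<^sup>2)\<^sup>2 / l ^ 3)"
    using l by (simp add: eval_nat_numeral)
  also have "\<dots> \<le> sign_exp M (\<lambda>\<epsilon>. (ip M \<epsilon> t)\<^sup>2) / l -
      4 / 27 * (sign_exp M (\<lambda>\<epsilon>. (ip M \<epsilon> t) ^ 4) / l ^ 3)"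
    using sign_exp_ip_power2[of M t 0] sign_exp_ip_power4[of M t] l
    by (intro diff_mono mult_left_mono divide_right_mono) (auto simp: l2)
  also have "\<dots> = sign_exp M (\<lambda>\<epsilon>. (ip M \<epsilon> t)\<^sup>2 / l - 4 / 27 * ((ip M \<epsilon> t) ^ 4 / l ^ 3))"
    by simp
  also have "\<dots> \<le> sign_exp M (\<lambda>\<epsilon>. \<bar>ip M \<epsilon> t\<bar>)"
    by (intro sign_exp_mono pw)
  finally show ?thesis by (simp add: l_def)
qed

text \<open>A maximum of two numbers is half their sum plus half their distance, and here the sum
  has mean zero. This bounds the diameter of T by the width and so provides the radius of the root
  piece.\<close>

lemma dist2_le_expected_max: "5 / 18 * dist2 M t s \<le> expected_max M {t, s}"
proof -
  define x where "x = (\<lambda>i. t i - s i)"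
  have "\<bar>ip M \<epsilon> x\<bar> + ip M \<epsilon> t + ip M \<epsilon> s \<le> 2 * hmax M {t, s} \<epsilon>" for \<epsilon>
    using hmax_ge[of "{t, s}" t \<epsilon> M] hmax_ge[of "{t, s}" s \<epsilon> M]
    unfolding x_def ip_diff_right by auto
  then have "sign_exp M (\<lambda>\<epsilon>. \<bar>ip M \<epsilon> x\<bar> + ip M \<epsilon> t + ip M \<epsilon> s) \<le> sign_exp M (\<lambda>\<epsilon>. 2 * hmax M {t, s} \<epsilon>)"
    by (intro sign_exp_mono)
  moreover have "sign_exp M (\<lambda>\<epsilon>. \<bar>ip M \<epsilon> x\<bar> + ip M \<epsilon> t + ip M \<epsilon> s) =
      sign_exp M (\<lambda>\<epsilon>. \<bar>ip M \<epsilon> x\<bar>) + sign_exp M (\<lambda>\<epsilon>. ip M \<epsilon> t) + sign_exp M (\<lambda>\<epsilon>. ip M \<epsilon> s)"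
    by (simp only: Bochner_Integration.integral_add integrable_signs)
  ultimately have "sign_exp M (\<lambda>\<epsilon>. \<bar>ip M \<epsilon> x\<bar>) \<le> 2 * expected_max M {t, s}"
    by (simp add: sign_exp_ip[of M t, simplified] sign_exp_ip expected_max_hmax)
  with sign_exp_abs_ip_ge[of x M] show ?thesis
    by (simp add: x_def dist2_def)
qed

section \<open>The tree of covers\<close>

text \<open>A separated set of largest cardinality covers, since an uncovered point could be added
  to it; the bound N makes a largest one exist.\<close>

lemma separated_cover:
  fixes N :: real
  assumes refl: "\<And>x. x \<in> X \<Longrightarrow> near x x" and sym: "\<And>x y. near x y \<Longrightarrow> near y x"
    and bound: "\<And>Q. Q \<subseteq> X \<Longrightarrow> finite Q \<Longrightarrow>
      (\<And>x y. x \<in> Q \<Longrightarrow> y \<in> Q \<Longrightarrow> x \<noteq> y \<Longrightarrow> \<not> near x y) \<Longrightarrow> real (card Q) \<le> N"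
  shows "\<exists>Q. Q \<subseteq> X \<and> finite Q \<and> real (card Q) \<le> N \<and> (\<forall>x\<in>X. \<exists>q\<in>Q. near q x)"
proof -
  define sep where "sep = (\<lambda>Q. Q \<subseteq> X \<and> finite Q \<and> (\<forall>x\<in>Q. \<forall>y\<in>Q. x \<noteq> y \<longrightarrow> \<not> near x y))"
  have card_le: "real (card Q) \<le> N" if "sep Q" for Q
    using that by (intro bound) (auto simp: sep_def)
  have "sep {}" by (simp add: sep_def)
  moreover have "card Q < nat \<lfloor>N\<rfloor> + 1" if "sep Q" for Q
    using card_le[OF that] by linarith
  ultimately obtain Q where Q: "sep Q" and max: "\<And>Q'. sep Q' \<Longrightarrow> card Q' \<le> card Q"
    using ex_has_greatest_nat[of sep "{}" card "nat \<lfloor>N\<rfloor> + 1"] by (metis less_imp_le)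
  have "\<exists>q\<in>Q. near q x" if x: "x \<in> X" for x
  proof (rule ccontr)
    assume far: "\<not> ?thesis"
    then have "x \<notin> Q" using refl[OF x] by blast
    moreover have "sep (insert x Q)"
    proof -
      have "\<not> near q x" "\<not> near x q" if "q \<in> Q" for q
        using far sym that by blast+
      then show ?thesis
        using Q x by (auto simp: sep_def)
    qed
    ultimately show False
      using max[of "insert x Q"] Q by (simp add: sep_def)
  qed
  then show ?thesis
    using Q card_le by (auto simp: sep_def)
qed

section \<open>Pieces and the moves between them\<close>

abbreviation sup_ball :: "nat \<Rightarrow> (nat \<Rightarrow> real) set \<Rightarrow> (nat \<Rightarrow> real) \<Rightarrow> real \<Rightarrow> (nat \<Rightarrow> real) set"
  where "sup_ball M T x r \<equiv> {y\<in>T. dist_sup M x y \<le> r}"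

lemma abs_diff_le_dist_sup: "i < M \<Longrightarrow> \<bar>x i - y i\<bar> \<le> dist_sup M x y"
  unfolding dist_sup_def by (intro Max_ge) auto

text \<open>The radius is chosen so that points whose balls meet the ball of a common centre differ
  by at most 4 * a / 2^(n + 1) in each coordinate: this is the diameter bound 2 * a divided by u =
  2^n, as the growth estimate demands.\<close>

definition thin :: "(nat \<Rightarrow> real) measure \<Rightarrow> nat \<Rightarrow> (nat \<Rightarrow> real) set \<Rightarrow> nat \<Rightarrow> real \<Rightarrow> (nat \<Rightarrow> real) \<Rightarrow> bool"
  where "thin \<nu> M T n a x \<longleftrightarrow> measure \<nu> (sup_ball M T x (a / 2 ^ (n + 1))) < exp (- (4 ^ n))"

text \<open>A predicate instead of a real supremum, which would carry no information for empty or
  unbounded families.\<close>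

definition width_le :: "nat \<Rightarrow> (nat \<Rightarrow> real) set \<Rightarrow> real \<Rightarrow> bool"
  where "width_le M A c \<longleftrightarrow> (\<forall>S. finite S \<longrightarrow> S \<noteq> {} \<longrightarrow> S \<subseteq> A \<longrightarrow> expected_max M S \<le> c)"

lemma width_le_mono: "width_le M A c \<Longrightarrow> B \<subseteq> A \<Longrightarrow> c \<le> c' \<Longrightarrow> width_le M B c'"
  unfolding width_le_def by (meson order_trans subset_trans)

abbreviation near_pts :: "nat \<Rightarrow> (nat \<Rightarrow> real) set \<Rightarrow> (nat \<Rightarrow> real) \<Rightarrow> real \<Rightarrow> (nat \<Rightarrow> real) set"
  where "near_pts M A t r \<equiv> {s\<in>A. dist2 M t s \<le> r}"

text \<open>
  The bounds \<open>w0\<close>, \<dots>, \<open>w3\<close> of a piece control the widths of the whole piece and of its parts of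
  radius \<open>rad / 256\<close>, \<open>rad / 256\<^sup>2\<close> and \<open>rad / 256\<^sup>3\<close>.
\<close>
datatype piece =
  Piece (pts: "(nat \<Rightarrow> real) set") (rad: real) (w0: real) (w1: real) (w2: real) (w3: real)

definition valid_piece :: "nat \<Rightarrow> (nat \<Rightarrow> real) set \<Rightarrow> piece \<Rightarrow> bool"
  where "valid_piece M T p \<longleftrightarrow> pts p \<noteq> {} \<and> pts p \<subseteq> T \<and> rad p > 0 \<and>
    (\<forall>x\<in>pts p. \<forall>y\<in>pts p. dist2 M x y \<le> 2 * rad p) \<and>
    w3 p \<le> w2 p \<and> w2 p \<le> w1 p \<and> w1 p \<le> w0 p \<and>
    width_le M (pts p) (w0 p) \<and>
    (\<forall>t\<in>pts p. width_le M (near_pts M (pts p) t (rad p / 256)) (w1 p) \<and>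
      width_le M (near_pts M (pts p) t (rad p / 256 ^ 2)) (w2 p) \<and>
      width_le M (near_pts M (pts p) t (rad p / 256 ^ 3)) (w3 p))"

text \<open>
  The constant \<open>2097152 = 32 * 256\<^sup>2\<close> comes from \<open>expected_max_growth\<close> with separation \<open>rad / 256\<close>,
  diameter \<open>2 * rad\<close> and radius \<open>rad / 256\<^sup>3\<close> for \<open>u = 2\<^sup>n\<close>.
\<close>
definition gain :: "nat \<Rightarrow> piece \<Rightarrow> real"
  where "gain n p = 2 ^ n * rad p / 2097152"

definition keeps :: "piece \<Rightarrow> piece \<Rightarrow> bool"
  where "keeps p p' \<longleftrightarrow> rad p' = rad p \<and> w0 p' = w0 p \<and> w1 p' = w1 p \<and> w2 p' = w2 p \<and> w3 p' = w3 p"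

text \<open>The widths move up by one scale. Nothing is recorded four scales down, so
  \<open>w3\<close> is repeated, which is sound because smaller balls have no larger width.\<close>

definition shrinks :: "piece \<Rightarrow> piece \<Rightarrow> bool"
  where "shrinks p p' \<longleftrightarrow> rad p' = rad p / 256 \<and> w0 p' = w1 p \<and> w1 p' = w2 p \<and> w2 p' = w3 p \<and> w3 p' = w3 p"

text \<open>The improvement concerns balls of radius \<open>rad / 256 ^ 3\<close> only, hence it
  enters \<open>w3\<close>; the minimum preserves the order of the bounds.\<close>

definition gains :: "nat \<Rightarrow> piece \<Rightarrow> piece \<Rightarrow> bool"
  where "gains n p p' \<longleftrightarrow> rad p' = rad p \<and> w0 p' = w0 p \<and> w1 p' = w1 p \<and> w2 p' = w2 p \<and>
    w3 p' = min (w3 p) (w0 p - gain n p)"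

definition step :: "(nat \<Rightarrow> real) measure \<Rightarrow> nat \<Rightarrow> (nat \<Rightarrow> real) set \<Rightarrow> nat \<Rightarrow> piece \<Rightarrow> piece \<Rightarrow> bool"
  where "step \<nu> M T n p p' \<longleftrightarrow>
    keeps p p' \<and> (\<forall>x\<in>pts p'. thin \<nu> M T n (rad p) x) \<or> shrinks p p' \<or> gains n p p'"

lemma dist2_self: "dist2 M x x = 0"
  by (simp add: dist2_def L2_set_def)

lemma dist2_commute: "dist2 M x y = dist2 M y x"
  by (simp add: dist2_def L2_set_def power2_commute)

lemma dist2_triangle: "dist2 M x z \<le> dist2 M x y + dist2 M y z"
  using L2_set_triangle_ineq[of "\<lambda>i. x i - y i" "\<lambda>i. y i - z i" "{..<M}"]
  by (simp add: dist2_def)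

lemma valid_piece_diam:
  "valid_piece M T p \<Longrightarrow> x \<in> pts p \<Longrightarrow> y \<in> pts p \<Longrightarrow> dist2 M x y \<le> 2 * rad p"
  by (simp add: valid_piece_def)

lemma valid_piece_width:
  assumes "valid_piece M T p"
  shows "width_le M (pts p) (w0 p)"
    and "t \<in> pts p \<Longrightarrow> width_le M (near_pts M (pts p) t (rad p / 256)) (w1 p)"
    and "t \<in> pts p \<Longrightarrow> width_le M (near_pts M (pts p) t (rad p / 256 ^ 2)) (w2 p)"
    and "t \<in> pts p \<Longrightarrow> width_le M (near_pts M (pts p) t (rad p / 256 ^ 3)) (w3 p)"
  using assms unfolding valid_piece_def by blast+

lemma valid_piece_w3_nonneg:
  assumes "valid_piece M T p"
  shows "0 \<le> w3 p"
proof -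
  obtain t where t: "t \<in> pts p" using assms by (auto simp: valid_piece_def)
  have "width_le M (near_pts M (pts p) t (rad p / 256 ^ 3)) (w3 p)" "rad p > 0"
    using assms t by (auto simp: valid_piece_def)
  then have "expected_max M {t} \<le> w3 p"
    using t by (auto simp: width_le_def dist2_self)
  then show ?thesis
    using expected_max_nonneg[of "{t}" M] by simp
qed

lemma valid_piece_subset:
  assumes p: "valid_piece M T p" and "keeps p p'" "pts p' \<subseteq> pts p" "pts p' \<noteq> {}"
  shows "valid_piece M T p'"
proof -
  have near: "width_le M (near_pts M (pts p') t r) c" if "width_le M (near_pts M (pts p) t r) c" for t r c
    using that assms(3) by (rule_tac width_le_mono) auto
  have "width_le M (pts p') (w0 p)"
    using valid_piece_width(1)[OF p] assms(3) by (rule width_le_mono) simp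
  moreover have "dist2 M x y \<le> 2 * rad p" if "x \<in> pts p'" "y \<in> pts p'" for x y
    using that assms(3) by (intro valid_piece_diam[OF p]) auto
  moreover have "width_le M (near_pts M (pts p') t (rad p / 256)) (w1 p)"
    "width_le M (near_pts M (pts p') t (rad p / 256 ^ 2)) (w2 p)"
    "width_le M (near_pts M (pts p') t (rad p / 256 ^ 3)) (w3 p)" if "t \<in> pts p'" for t
    by (intro near valid_piece_width[OF p], use that assms(3) in blast)+
  moreover have "pts p' \<subseteq> T"
    using p assms(3) by (auto simp: valid_piece_def)
  ultimately show ?thesis
    using assms unfolding valid_piece_def keeps_def by simp
qed

text \<open>Pigeonhole for \<nu>: points that are pairwise not near have disjoint balls, each of
  mass at least exp (-4^n).\<close>

lemma thick_cover:
  assumes "prob_space \<nu>" and meas: "\<And>x r. x \<in> T \<Longrightarrow> sup_ball M T x r \<in> sets \<nu>"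
    and X: "X \<subseteq> T" "\<And>x. x \<in> X \<Longrightarrow> \<not> thin \<nu> M T n a x"
  defines "near \<equiv> \<lambda>x y. \<exists>z\<in>T. dist_sup M x z \<le> a / 2 ^ (n + 1) \<and> dist_sup M y z \<le> a / 2 ^ (n + 1)"
  shows "\<exists>Q. Q \<subseteq> X \<and> finite Q \<and> real (card Q) \<le> exp (4 ^ n) \<and> (\<forall>x\<in>X. \<exists>q\<in>Q. near q x)"
proof (rule separated_cover)
  interpret prob_space \<nu> by fact
  let ?B = "\<lambda>x. sup_ball M T x (a / 2 ^ (n + 1))"
  have thick: "exp (- (4 ^ n)) \<le> measure \<nu> (?B x)" if "x \<in> X" for x
    using X(2)[OF that] by (simp add: thin_def)
  show "near x x" if "x \<in> X" for x
  proof (rule ccontr)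
    \<comment> \<open>A thick ball has positive mass, hence contains a point, which is the required
      z.\<close>
    assume "\<not> near x x"
    then have "?B x = {}" by (auto simp: near_def)
    with thick[OF that] have "exp (- (4 ^ n)) \<le> measure \<nu> {}" by metis
    then show False by simp
  qed
  show "near y x" if "near x y" for x y
    using that by (auto simp: near_def)
  fix Q assume Q: "Q \<subseteq> X" "finite Q" and far: "\<And>x y. x \<in> Q \<Longrightarrow> y \<in> Q \<Longrightarrow> x \<noteq> y \<Longrightarrow> \<not> near x y"
  have "disjoint_family_on ?B Q"
    unfolding disjoint_family_on_def
  proof (intro ballI impI)
    fix x y assume "x \<in> Q" "y \<in> Q" "x \<noteq> y"
    then show "?B x \<inter> ?B y = {}"
      using far[of x y] unfolding near_def by blast
  qed
  have "real (card Q) * exp (- (4 ^ n)) = (\<Sum>x\<in>Q. exp (- (4 ^ n)))"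
    by simp
  also have "\<dots> \<le> (\<Sum>x\<in>Q. measure \<nu> (?B x))"
    using Q thick by (intro sum_mono) auto
  also have "\<dots> = measure \<nu> (\<Union>x\<in>Q. ?B x)"
    using Q X meas \<open>disjoint_family_on ?B Q\<close> by (intro finite_measure_finite_Union[symmetric]) auto
  also have "\<dots> \<le> 1" by simp
  finally show "real (card Q) \<le> exp (4 ^ n)"
    by (simp add: exp_minus field_simps)
qed

text \<open>Too many separated points of \<open>X\<close> would contradict the width
  \<open>w0 p\<close>: each of their small balls already has width above
  \<open>w0 p - gain n p\<close>, and the growth estimate with u = 2^n and R = 2 *
  \<open>rad p\<close> adds \<open>gain n p\<close>.\<close>

lemma wide_cover:
  assumes p: "valid_piece M T p" and A: "A \<subseteq> pts p"
    and sup_diam: "\<And>x y i. x \<in> A \<Longrightarrow> y \<in> A \<Longrightarrow> i < M \<Longrightarrow> \<bar>x i - y i\<bar> \<le> 2 * rad p / 2 ^ n"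
  defines "X \<equiv> {t\<in>A. \<not> width_le M (near_pts M A t (rad p / 256 ^ 3)) (w0 p - gain n p)}"
  shows "\<exists>Q. Q \<subseteq> X \<and> finite Q \<and> real (card Q) \<le> 4 * exp (4 ^ n) \<and>
    (\<forall>x\<in>X. \<exists>q\<in>Q. dist2 M q x < rad p / 256)"
proof (rule separated_cover)
  have rad: "rad p > 0" using p by (simp add: valid_piece_def)
  then show "dist2 M x x < rad p / 256" for x
    by (simp add: dist2_self)
  show "dist2 M y x < rad p / 256" if "dist2 M x y < rad p / 256" for x y
    using that by (simp add: dist2_commute)
  fix Q assume Q: "Q \<subseteq> X" "finite Q"
    and far: "\<And>x y. x \<in> Q \<Longrightarrow> y \<in> Q \<Longrightarrow> x \<noteq> y \<Longrightarrow> \<not> dist2 M x y < rad p / 256"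
  show "real (card Q) \<le> 4 * exp (4 ^ n)"
  proof (rule ccontr)
    assume "\<not> ?thesis"
    then have card: "4 * exp (4 ^ n) < real (card Q)" by simp
    then have "Q \<noteq> {}" by auto
    have "\<forall>t\<in>Q. \<exists>S. finite S \<and> S \<noteq> {} \<and> S \<subseteq> near_pts M A t (rad p / 256 ^ 3) \<and>
        w0 p - gain n p < expected_max M S"
    proof
      fix t assume "t \<in> Q"
      then have "\<not> width_le M (near_pts M A t (rad p / 256 ^ 3)) (w0 p - gain n p)"
        using Q unfolding X_def by blast
      then show "\<exists>S. finite S \<and> S \<noteq> {} \<and> S \<subseteq> near_pts M A t (rad p / 256 ^ 3) \<and>
          w0 p - gain n p < expected_max M S"
        unfolding width_le_def not_le[symmetric] by blast
    qed
    from bchoice[OF this] obtain H where H: "\<forall>t\<in>Q. finite (H t) \<and> H t \<noteq> {} \<and>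
        H t \<subseteq> near_pts M A t (rad p / 256 ^ 3) \<and> w0 p - gain n p < expected_max M (H t)" ..
    define h where "h = Min ((\<lambda>t. expected_max M (H t)) ` Q)"
    have "w0 p - gain n p < h"
      unfolding h_def using Q \<open>Q \<noteq> {}\<close> H by (subst Min_gr_iff) auto
    have QA: "Q \<subseteq> A" using Q by (auto simp: X_def)
    have "h + 2 ^ n * (rad p / 256)\<^sup>2 / (8 * (2 * rad p)) - 8 * 2 ^ n * (rad p / 256 ^ 3) \<le>
        expected_max M (\<Union>t\<in>Q. H t)"
    proof (rule expected_max_growth[OF \<open>finite Q\<close>])
      show "4 * exp ((2 ^ n)\<^sup>2) < real (card Q)"
        using card by (simp add: power_mult[symmetric] mult.commute[of n] power_mult)
      show "dist2 M t s \<le> 2 * rad p" if "t \<in> Q" "s \<in> Q" for t s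
        using that QA A by (intro valid_piece_diam[OF p]) auto
      show "\<bar>t i - s i\<bar> \<le> 2 * rad p / 2 ^ n" if "t \<in> Q" "s \<in> Q" "i < M" for t s i
        using sup_diam that QA by blast
      show "rad p / 256 \<le> dist2 M t s" if "t \<in> Q" "s \<in> Q" "t \<noteq> s" for t s
        using far[OF that] by simp
      show "dist2 M t s \<le> rad p / 256 ^ 3" if "t \<in> Q" "s \<in> H t" for t s
        using H that by blast
      show "h \<le> expected_max M (H t)" if "t \<in> Q" for t
        unfolding h_def using Q that by (intro Min_le) auto
    qed (use rad H in auto)
    also have "h + 2 ^ n * (rad p / 256)\<^sup>2 / (8 * (2 * rad p)) - 8 * 2 ^ n * (rad p / 256 ^ 3) =
        h + gain n p"
      using rad by (simp add: gain_def power2_eq_square)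
    also have "expected_max M (\<Union>t\<in>Q. H t) \<le> w0 p"
    proof -
      have "width_le M (pts p) (w0 p)" using p by (simp add: valid_piece_def)
      moreover have "(\<Union>t\<in>Q. H t) \<subseteq> pts p" using H A by blast
      ultimately show ?thesis
        using H Q \<open>Q \<noteq> {}\<close> by (auto simp: width_le_def)
    qed
    finally show False
      using \<open>w0 p - gain n p < h\<close> by simp
  qed
qed

lemma valid_piece_shrink:
  assumes p: "valid_piece M T p" and q: "q \<in> pts p" and Y: "Y \<noteq> {}" "Y \<subseteq> near_pts M (pts p) q (rad p / 256)"
  shows "valid_piece M T (Piece Y (rad p / 256) (w1 p) (w2 p) (w3 p) (w3 p))"
proof -
  have rad: "rad p > 0" using p by (simp add: valid_piece_def)
  have Yp: "Y \<subseteq> pts p" using Y by blast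
  have "dist2 M x y \<le> 2 * (rad p / 256)" if "x \<in> Y" "y \<in> Y" for x y
  proof -
    have "dist2 M x q \<le> rad p / 256" "dist2 M q y \<le> rad p / 256"
      using that Y by (auto simp: dist2_commute[of M x])
    then show ?thesis
      using dist2_triangle[of M x y q] by simp
  qed
  moreover have "width_le M Y (w1 p)"
    using valid_piece_width(2)[OF p q] Y(2) by (rule width_le_mono) simp
  moreover have "width_le M (near_pts M Y t (rad p / 256 / 256)) (w2 p)" if "t \<in> Y" for t
    using valid_piece_width(3)[OF p subsetD[OF Yp that]]
    by (rule width_le_mono) (use Yp in auto)
  \<comment> \<open>Used for k = 2, where the radius is exactly the one of \<open>w3 p\<close>, and
    for k = 3, where the ball is smaller still.\<close>
  moreover have w: "width_le M (near_pts M Y t (rad p / 256 / 256 ^ k)) (w3 p)"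
    if t: "t \<in> Y" and k: "2 \<le> k" for t k
    using valid_piece_width(4)[OF p subsetD[OF Yp t]]
  proof (rule width_le_mono)
    have "rad p / (256 * 256 ^ k) \<le> rad p / 256 ^ 3"
      using rad power_increasing[OF k, of "256 :: real"] by (intro divide_left_mono) auto
    then show "near_pts M Y t (rad p / 256 / 256 ^ k) \<subseteq> near_pts M (pts p) t (rad p / 256 ^ 3)"
      using Yp by (auto intro: order_trans)
  qed simp
  moreover have "Y \<subseteq> T" "w3 p \<le> w2 p" "w2 p \<le> w1 p"
    using p Yp by (auto simp: valid_piece_def)
  ultimately show ?thesis
    using Y rad w[of _ 2] w[of _ 3] unfolding valid_piece_def by simp
qed

lemma valid_piece_gain:
  assumes p: "valid_piece M T p" and A: "A \<subseteq> pts p" and Y: "Y \<noteq> {}" "Y \<subseteq> A"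
    and width: "\<And>t. t \<in> Y \<Longrightarrow> width_le M (near_pts M A t (rad p / 256 ^ 3)) c"
  shows "valid_piece M T (Piece Y (rad p) (w0 p) (w1 p) (w2 p) (min (w3 p) c))"
proof -
  define p' where "p' = Piece Y (rad p) (w0 p) (w1 p) (w2 p) (w3 p)"
  have p': "valid_piece M T p'"
    by (rule valid_piece_subset[OF p]) (use A Y in \<open>auto simp: p'_def keeps_def\<close>)
  have "width_le M (near_pts M Y t (rad p / 256 ^ 3)) (min (w3 p) c)" if t: "t \<in> Y" for t
  proof -
    have "width_le M (near_pts M Y t (rad p / 256 ^ 3)) (w3 p)"
      using valid_piece_width(4)[OF p'] t by (simp add: p'_def)
    moreover have "width_le M (near_pts M Y t (rad p / 256 ^ 3)) c"
      using width[OF t] by (rule width_le_mono) (use Y in auto)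
    ultimately show ?thesis
      by (simp add: width_le_def)
  qed
  then show ?thesis
    using p' unfolding valid_piece_def p'_def by (simp add: min.coboundedI1)
qed

text \<open>Counting with e = exp (4^n), which is at least 2: one kept piece and, for each of at
  most e thick parts, one gaining piece and at most 4 * e shrunken ones. Then 1 + e * (1 + 4 * e) is
  at most 8 * e^2, hence at most e^5.\<close>

lemma step_cover:
  assumes \<nu>: "prob_space \<nu>" and meas: "\<And>x r. x \<in> T \<Longrightarrow> sup_ball M T x r \<in> sets \<nu>"
    and p: "valid_piece M T p"
  shows "\<exists>F. finite F \<and> real (card F) \<le> exp (5 * 4 ^ n) \<and>
    (\<forall>p'\<in>F. valid_piece M T p' \<and> step \<nu> M T n p p') \<and> pts p \<subseteq> (\<Union>p'\<in>F. pts p')"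
proof -
  define B where "B = {x\<in>pts p. thin \<nu> M T n (rad p) x}"
  define G where "G = pts p - B"
  define near where "near = (\<lambda>x y. \<exists>z\<in>T. dist_sup M x z \<le> rad p / 2 ^ (n + 1) \<and>
    dist_sup M y z \<le> rad p / 2 ^ (n + 1))"
  have G: "G \<subseteq> T" "\<And>x. x \<in> G \<Longrightarrow> \<not> thin \<nu> M T n (rad p) x"
    using p by (auto simp: G_def B_def valid_piece_def)
  obtain C where C: "C \<subseteq> G" "finite C" "real (card C) \<le> exp (4 ^ n)" "\<And>x. x \<in> G \<Longrightarrow> \<exists>c\<in>C. near c x"
    using thick_cover[OF \<nu> meas G] unfolding near_def by blast
  define A where "A = (\<lambda>c. {x\<in>G. near c x})"
  have A: "A c \<subseteq> pts p" for c by (auto simp: A_def G_def)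
  have sup_diam: "\<bar>x i - y i\<bar> \<le> 2 * rad p / 2 ^ n" if "x \<in> A c" "y \<in> A c" "i < M" for x y i c
  proof -
    obtain z z' where z: "dist_sup M c z \<le> rad p / 2 ^ (n + 1)" "dist_sup M x z \<le> rad p / 2 ^ (n + 1)"
      "dist_sup M c z' \<le> rad p / 2 ^ (n + 1)" "dist_sup M y z' \<le> rad p / 2 ^ (n + 1)"
      using \<open>x \<in> A c\<close> \<open>y \<in> A c\<close> unfolding A_def near_def by blast
    have "\<bar>x i - y i\<bar> \<le> dist_sup M x z + dist_sup M c z + dist_sup M c z' + dist_sup M y z'"
      using abs_diff_le_dist_sup[OF \<open>i < M\<close>, of x z] abs_diff_le_dist_sup[OF \<open>i < M\<close>, of c z]
        abs_diff_le_dist_sup[OF \<open>i < M\<close>, of c z'] abs_diff_le_dist_sup[OF \<open>i < M\<close>, of y z']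
      by linarith
    also have "\<dots> \<le> 4 * (rad p / 2 ^ (n + 1))" using z by linarith
    finally show ?thesis by simp
  qed
  define X where "X = (\<lambda>c. {t\<in>A c. \<not> width_le M (near_pts M (A c) t (rad p / 256 ^ 3)) (w0 p - gain n p)})"
  have "\<forall>c. \<exists>Q. Q \<subseteq> X c \<and> finite Q \<and> real (card Q) \<le> 4 * exp (4 ^ n) \<and>
      (\<forall>x\<in>X c. \<exists>q\<in>Q. dist2 M q x < rad p / 256)"
    unfolding X_def by (intro allI wide_cover[OF p A] sup_diam)
  from choice[OF this] obtain Q where Q: "\<And>c. Q c \<subseteq> X c" "\<And>c. finite (Q c)"
    "\<And>c. real (card (Q c)) \<le> 4 * exp (4 ^ n)"
    "\<And>c x. x \<in> X c \<Longrightarrow> \<exists>q\<in>Q c. dist2 M q x < rad p / 256" by blast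
  define kp where "kp = Piece B (rad p) (w0 p) (w1 p) (w2 p) (w3 p)"
  define gn where "gn = (\<lambda>c. Piece (A c - X c) (rad p) (w0 p) (w1 p) (w2 p) (min (w3 p) (w0 p - gain n p)))"
  define sh where "sh = (\<lambda>c q. Piece {x\<in>X c. dist2 M q x < rad p / 256} (rad p / 256) (w1 p) (w2 p) (w3 p) (w3 p))"
  define F where "F = insert kp (\<Union>c\<in>C. insert (gn c) (sh c ` Q c))"
  have fin: "finite F" using C Q by (auto simp: F_def)
  \<comment> \<open>Candidates may be empty, while a valid piece has a point; the empty ones are
    discarded in the end.\<close>
  have "valid_piece M T p' \<and> step \<nu> M T n p p'" if "p' \<in> F" and ne: "pts p' \<noteq> {}" for p'
  proof -
    from \<open>p' \<in> F\<close> consider "p' = kp" | c where "p' = gn c" | c q where "q \<in> Q c" "p' = sh c q"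
      unfolding F_def by blast
    then show ?thesis
    proof cases
      case 1
      have k: "keeps p p'" "pts p' \<subseteq> pts p" "\<forall>x\<in>pts p'. thin \<nu> M T n (rad p) x"
        by (auto simp: 1 kp_def keeps_def B_def)
      then show ?thesis
        using valid_piece_subset[OF p k(1,2) ne] by (simp add: step_def)
    next
      case 2
      have "valid_piece M T p'"
        unfolding 2 gn_def by (rule valid_piece_gain[OF p A]) (use ne in \<open>auto simp: 2 gn_def X_def\<close>)
      then show ?thesis
        by (simp add: 2 gn_def step_def gains_def)
    next
      case 3
      have "q \<in> pts p" using 3 Q(1)[of c] A[of c] by (auto simp: X_def)
      then have "valid_piece M T p'"
        unfolding 3 sh_def
        by (rule valid_piece_shrink[OF p]) (use ne A[of c] in \<open>auto simp: 3 sh_def X_def\<close>)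
      then show ?thesis
        by (simp add: 3 sh_def step_def shrinks_def)
    qed
  qed
  moreover have "\<exists>p'\<in>F. x \<in> pts p'" if x: "x \<in> pts p" for x
  proof (cases "x \<in> B")
    case True
    then show ?thesis by (auto simp: F_def kp_def)
  next
    case False
    then obtain c where c: "c \<in> C" "x \<in> A c"
      using C(4)[of x] x by (auto simp: G_def A_def)
    show ?thesis
    proof (cases "x \<in> X c")
      case True
      then obtain q where q: "q \<in> Q c" "dist2 M q x < rad p / 256" using Q(4) by blast
      have "sh c q \<in> F" using q c by (auto simp: F_def)
      moreover have "x \<in> pts (sh c q)" using True q by (simp add: sh_def)
      ultimately show ?thesis by blast
    next
      case False
      then have "gn c \<in> F" "x \<in> pts (gn c)" using c by (auto simp: F_def gn_def)
      then show ?thesis by blast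
    qed
  qed
  moreover have "real (card {p'\<in>F. pts p' \<noteq> {}}) \<le> exp (5 * 4 ^ n)"
  proof -
    let ?e = "exp (4 ^ n :: real)"
    have e: "?e \<ge> 2"
      using exp_ge_add_one_self[of "4 ^ n :: real"] one_le_power[of "4 :: real" n] by linarith
    have cQ: "real (card (insert (gn c) (sh c ` Q c))) \<le> 1 + 4 * ?e" for c
    proof -
      have "card (insert (gn c) (sh c ` Q c)) \<le> Suc (card (sh c ` Q c))"
        using Q by (simp add: card_insert_if)
      also have "\<dots> \<le> Suc (card (Q c))"
        using card_image_le[OF Q(2)] by simp
      finally have "card (insert (gn c) (sh c ` Q c)) \<le> Suc (card (Q c))" .
      then show ?thesis using Q(3)[of c] by linarith
    qed
    have "card {p'\<in>F. pts p' \<noteq> {}} \<le> card F"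
      using fin by (intro card_mono) auto
    also have "\<dots> \<le> Suc (card (\<Union>c\<in>C. insert (gn c) (sh c ` Q c)))"
      unfolding F_def using C Q by (simp add: card_insert_if)
    also have "\<dots> \<le> Suc (\<Sum>c\<in>C. card (insert (gn c) (sh c ` Q c)))"
      using C by (simp only: Suc_le_mono card_UN_le)
    finally have "real (card {p'\<in>F. pts p' \<noteq> {}}) \<le> 1 + (\<Sum>c\<in>C. real (card (insert (gn c) (sh c ` Q c))))"
      by (simp flip: of_nat_sum of_nat_Suc del: of_nat_Suc)
    also have "\<dots> \<le> 1 + (\<Sum>c\<in>C. 1 + 4 * ?e)"
      by (intro add_left_mono sum_mono cQ)
    also have "\<dots> = 1 + card C * (1 + 4 * ?e)" by simp
    also have "\<dots> \<le> 1 + ?e * (1 + 4 * ?e)"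
      using C by (intro add_left_mono mult_right_mono) auto
    also have "\<dots> \<le> 8 * ?e ^ 2"
    proof -
      have "2 * ?e \<le> ?e ^ 2"
        unfolding power2_eq_square using e by (intro mult_right_mono) auto
      moreover have "1 + ?e * (1 + 4 * ?e) = 1 + ?e + 4 * ?e ^ 2"
        by (simp add: power2_eq_square algebra_simps)
      ultimately show ?thesis using e by linarith
    qed
    also have "\<dots> \<le> ?e ^ 3 * ?e ^ 2"
      using power_mono[OF e, of 3] by (intro mult_right_mono) auto
    also have "\<dots> = exp (5 * 4 ^ n)"
      by (simp flip: power_add exp_of_nat_mult exp_add)
    finally show ?thesis .
  qed
  ultimately show ?thesis
    using fin by (intro exI[of _ "{p'\<in>F. pts p' \<noteq> {}}"] conjI ballI subsetI) (simp, simp, blast+)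
qed

text \<open>The cardinalities close up because 2 * 4^n + 5 * 4^n is at most 2 * 4^(n + 1). Pieces of
  one level may overlap; \<open>branch\<close> selects, level by level, a child that contains
  x.\<close>

lemma piece_tree:
  assumes \<nu>: "prob_space \<nu>" and meas: "\<And>x r. x \<in> T \<Longrightarrow> sup_ball M T x r \<in> sets \<nu>"
    and p0: "valid_piece M T p0"
  obtains lev :: "nat \<Rightarrow> piece set" and branch :: "(nat \<Rightarrow> real) \<Rightarrow> nat \<Rightarrow> piece"
  where "\<And>n. finite (lev n)" "\<And>n. lev n \<noteq> {}" "\<And>n. real (card (lev n)) \<le> exp (2 * 4 ^ n)"
    "\<And>n p. p \<in> lev n \<Longrightarrow> valid_piece M T p"
    "\<And>x. x \<in> pts p0 \<Longrightarrow> branch x 0 = p0"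
    "\<And>x n. x \<in> pts p0 \<Longrightarrow> branch x n \<in> lev n"
    "\<And>x n. x \<in> pts p0 \<Longrightarrow> x \<in> pts (branch x n)"
    "\<And>x n. x \<in> pts p0 \<Longrightarrow> step \<nu> M T n (branch x n) (branch x (Suc n))"
proof -
  define nxt where "nxt = (\<lambda>n p. SOME F. finite F \<and> real (card F) \<le> exp (5 * 4 ^ n) \<and>
    (\<forall>p'\<in>F. valid_piece M T p' \<and> step \<nu> M T n p p') \<and> pts p \<subseteq> (\<Union>p'\<in>F. pts p'))"
  have nxt: "finite (nxt n p) \<and> real (card (nxt n p)) \<le> exp (5 * 4 ^ n) \<and>
      (\<forall>p'\<in>nxt n p. valid_piece M T p' \<and> step \<nu> M T n p p') \<and> pts p \<subseteq> (\<Union>p'\<in>nxt n p. pts p')"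
    if "valid_piece M T p" for n p
    unfolding nxt_def by (rule someI_ex) (rule step_cover[OF \<nu> meas that])
  define lev where "lev = rec_nat {p0} (\<lambda>n L. \<Union>p\<in>L. nxt n p)"
  have lev_simps: "lev 0 = {p0}" "lev (Suc n) = (\<Union>p\<in>lev n. nxt n p)" for n
    by (simp_all add: lev_def)
  have lev: "finite (lev n) \<and> (\<forall>p\<in>lev n. valid_piece M T p) \<and> real (card (lev n)) \<le> exp (2 * 4 ^ n)" for n
  proof (induction n)
    case 0
    show ?case using p0 exp_ge_add_one_self[of 2] by (simp add: lev_simps)
  next
    case (Suc n)
    have "card (lev (Suc n)) \<le> (\<Sum>p\<in>lev n. card (nxt n p))"
      unfolding lev_simps using Suc.IH by (intro card_UN_le) auto
    then have "real (card (lev (Suc n))) \<le> (\<Sum>p\<in>lev n. real (card (nxt n p)))"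
      by (simp flip: of_nat_sum)
    also have "\<dots> \<le> (\<Sum>p\<in>lev n. exp (5 * 4 ^ n))"
      using Suc.IH nxt by (intro sum_mono) auto
    also have "\<dots> = card (lev n) * exp (5 * 4 ^ n)" by simp
    also have "\<dots> \<le> exp (2 * 4 ^ n) * exp (5 * 4 ^ n)"
      using Suc.IH by (intro mult_right_mono) auto
    also have "\<dots> \<le> exp (2 * 4 ^ Suc n)"
      by (simp flip: exp_add)
    finally show ?case using Suc.IH nxt by (auto simp: lev_simps)
  qed
  define branch where "branch = (\<lambda>x. rec_nat p0 (\<lambda>n p. SOME p'. p' \<in> nxt n p \<and> x \<in> pts p'))"
  have branch_simps: "branch x 0 = p0" "branch x (Suc n) = (SOME p'. p' \<in> nxt n (branch x n) \<and> x \<in> pts p')" for x n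
    by (simp_all add: branch_def)
  have branch_Suc: "branch x (Suc n) \<in> nxt n (branch x n) \<and> x \<in> pts (branch x (Suc n))"
    if "branch x n \<in> lev n" "x \<in> pts (branch x n)" for x n
  proof -
    have "\<exists>p'. p' \<in> nxt n (branch x n) \<and> x \<in> pts p'"
      using nxt[of "branch x n" n] lev[of n] that by blast
    from someI_ex[OF this] show ?thesis unfolding branch_simps .
  qed
  have branch: "branch x n \<in> lev n \<and> x \<in> pts (branch x n)" if "x \<in> pts p0" for x n
  proof (induction n)
    case (Suc n)
    then show ?case using branch_Suc[of x n] by (auto simp: lev_simps)
  qed (use that in \<open>simp add: branch_simps lev_simps\<close>)
  obtain x0 where x0: "x0 \<in> pts p0" using p0 by (auto simp: valid_piece_def)
  show ?thesis
  proof (rule that[of lev branch])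
    show "lev n \<noteq> {}" for n using branch[OF x0, of n] by auto
    show "step \<nu> M T n (branch x n) (branch x (Suc n))" if "x \<in> pts p0" for x n
      using branch[OF that, of n] branch_Suc[of x n] nxt[of "branch x n" n] lev[of n] by blast
  qed (use lev branch branch_simps in auto)
qed

section \<open>Charging the radii along a branch\<close>

text \<open>
  Potential argument: shrinking a piece lowers \<open>w0 + w1 + w2\<close> by \<open>w0 - w3\<close>, and \<open>z\<close> is the part of
  \<open>w0 - w3\<close> that has been spent on the gaining steps since the last shrinking.
\<close>
lemma path_sum_le:
  fixes q :: "nat \<Rightarrow> piece"
  assumes valid: "\<And>n. valid_piece M T (q n)" and step: "\<And>n. step \<nu> M T n (q n) (q (Suc n))"
    and x: "\<And>n. x \<in> pts (q n)"
    and W: "w0 (q 0) = W" "w1 (q 0) = W" "w2 (q 0) = W"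
  shows "(\<Sum>k<n. 2 ^ k * rad (q k)) \<le> 62914560 * W +
    5 * (\<Sum>k<n. if thin \<nu> M T k (rad (q k)) x then 2 ^ k * rad (q k) else 0) + 4 * rad (q 0)"
proof -
  define S where "S = (\<lambda>k. 2 ^ k * rad (q k))"
  define D where "D = (\<lambda>n. \<Sum>k<n. if thin \<nu> M T k (rad (q k)) x then S k else 0)"
  have rad: "rad (q k) > 0" and ord: "w3 (q k) \<le> w2 (q k)" "w2 (q k) \<le> w1 (q k)" "w1 (q k) \<le> w0 (q k)" for k
    using valid[of k] by (auto simp: valid_piece_def)
  have S: "S k > 0" for k using rad by (simp add: S_def)
  \<comment> \<open>If S doubles, the left side grows by 5 * S n. A keeping step is paid by D. A
    gaining step is paid by z, which becomes at most 10 * S n while \<open>w0 - w3\<close> is at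
    least S n / 2097152, whence 20971520 = 10 * 2097152. A shrinking step makes the left side fall,
    as S drops by the factor 128, and the potential absorbs z.\<close>
  have "\<exists>z. 0 \<le> z \<and> z \<le> 5 * S n \<and> z \<le> 20971520 * (w0 (q n) - w3 (q n)) \<and>
      (\<Sum>k<n. S k) + 4 * S n \<le>
        20971520 * (3 * W - w0 (q n) - w1 (q n) - w2 (q n)) + z + 5 * D n + 4 * S 0" for n
  proof (induction n)
    case 0
    show ?case using W ord[of 0] S[of 0] by (intro exI[of _ 0]) (auto simp: D_def)
  next
    case (Suc n)
    then obtain z where z: "0 \<le> z" "z \<le> 5 * S n" "z \<le> 20971520 * (w0 (q n) - w3 (q n))"
      and IH: "(\<Sum>k<n. S k) + 4 * S n \<le>
        20971520 * (3 * W - w0 (q n) - w1 (q n) - w2 (q n)) + z + 5 * D n + 4 * S 0"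
      by blast
    have D: "D n \<le> D (Suc n)" using S[of n] by (simp add: D_def)
    from step[of n] consider
      "keeps (q n) (q (Suc n))" "thin \<nu> M T n (rad (q n)) x"
      | "shrinks (q n) (q (Suc n))" | "gains n (q n) (q (Suc n))"
      using x by (auto simp: step_def)
    then show ?case
    proof cases
      case 1
      then have "D (Suc n) = D n + S n" "S (Suc n) = 2 * S n"
        by (auto simp: D_def S_def keeps_def)
      then show ?thesis
        using 1 z IH S[of n] by (intro exI[of _ z]) (auto simp: keeps_def)
    next
      case 2
      then have "S (Suc n) = S n / 128"
        by (auto simp: S_def shrinks_def)
      then show ?thesis
        using 2 z IH S[of n] D ord[of n] by (intro exI[of _ 0]) (auto simp: shrinks_def)
    next
      case 3
      then have "S (Suc n) = 2 * S n" by (auto simp: S_def gains_def)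
      moreover have "gain n (q n) = S n / 2097152" by (simp add: gain_def S_def)
      ultimately show ?thesis
        using 3 z IH S[of n] D by (intro exI[of _ "z + 5 * S n"]) (auto simp: gains_def min_def)
    qed
  qed
  from this[of n] obtain z where z: "z \<le> 20971520 * (w0 (q n) - w3 (q n))"
    "(\<Sum>k<n. S k) + 4 * S n \<le>
      20971520 * (3 * W - w0 (q n) - w1 (q n) - w2 (q n)) + z + 5 * D n + 4 * S 0"
    by blast
  moreover have "w3 (q n) \<ge> 0" by (rule valid_piece_w3_nonneg[OF valid])
  ultimately have "(\<Sum>k<n. S k) \<le> 62914560 * W + 5 * D n + 4 * S 0"
    using S[of n] ord[of n] by (simp add: algebra_simps)
  then show ?thesis by (simp add: S_def D_def cong: if_cong)
qed

text \<open>The scales l k = r k / 2^(k + 1) at least halve at each step, so the intervals from l k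
  / 2 to l k are disjoint. For a thin k the integrand is at least 4^k there, and 4^k * l k / 2 is a
  quarter of 2^k * r k.\<close>

lemma thin_sum_le:
  fixes r :: "nat \<Rightarrow> real"
  assumes "prob_space \<nu>" and meas: "\<And>r. sup_ball M T x r \<in> sets \<nu>"
    and r: "\<And>k. r k > 0" "\<And>k. r (Suc k) \<le> r k"
    and G: "(\<integral>\<^sup>+\<epsilon>\<in>{0..}. log_inv_powr 1 (measure \<nu> (sup_ball M T x \<epsilon>)) \<partial>lborel) \<le> ennreal G" "G \<ge> 0"
  shows "(\<Sum>k<n. if thin \<nu> M T k (r k) x then 2 ^ k * r k else 0) \<le> 4 * G"
proof -
  interpret prob_space \<nu> by fact
  define l where "l = (\<lambda>k. r k / 2 ^ (k + 1))"
  define I where "I = (\<lambda>k. {l k / 2<..l k})"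
  define K where "K = {k\<in>{..<n}. thin \<nu> M T k (r k) x}"
  have l: "l k > 0" "l (Suc k) \<le> l k / 2" for k
    using r[of k] by (auto simp: l_def divide_right_mono)
  have l_mono: "l j \<le> l k / 2" if "k < j" for j k
    using that
  proof (induction j rule: less_Suc_induct)
    case (2 i j k)
    then show ?case using l(1)[of j] by linarith
  qed (rule l(2))
  have disj: "k = j" if "\<epsilon> \<in> I k" "\<epsilon> \<in> I j" for k j \<epsilon>
    using l_mono[of k j] l_mono[of j k] that by (cases k j rule: linorder_cases) (auto simp: I_def)
  have pw: "(\<Sum>k\<in>K. ennreal (4 ^ k) * indicator (I k) \<epsilon>) \<le>
      log_inv_powr 1 (prob (sup_ball M T x \<epsilon>)) * indicator {0..} \<epsilon>" for \<epsilon>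
  proof (cases "\<exists>k\<in>K. \<epsilon> \<in> I k")
    case True
    then obtain k where k: "k \<in> K" "\<epsilon> \<in> I k" by blast
    have "(\<Sum>k\<in>K. ennreal (4 ^ k) * indicator (I k) \<epsilon>) = (\<Sum>j\<in>{k}. ennreal (4 ^ j) * indicator (I j) \<epsilon>)"
      using k disj[of \<epsilon>] by (intro sum.mono_neutral_right) (auto simp: K_def indicator_def)
    also have "\<dots> = ennreal (4 ^ k)" using k by simp
    also have "\<dots> \<le> log_inv_powr 1 (prob (sup_ball M T x \<epsilon>))"
    proof -
      have "prob (sup_ball M T x \<epsilon>) \<le> prob (sup_ball M T x (l k))"
        using meas k by (intro finite_measure_mono) (auto simp: I_def)
      also have "\<dots> < exp (- (4 ^ k))"
        using k by (simp add: K_def thin_def l_def)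
      finally have P: "prob (sup_ball M T x \<epsilon>) < exp (- (4 ^ k))" .
      show ?thesis
      proof (cases "prob (sup_ball M T x \<epsilon>) = 0")
        case False
        then have pos: "prob (sup_ball M T x \<epsilon>) > 0" by (simp add: less_le)
        then have "ln (prob (sup_ball M T x \<epsilon>)) < - (4 ^ k)"
          using P by (metis ln_exp ln_less_cancel_iff exp_gt_zero)
        then have "4 ^ k \<le> ln (1 / prob (sup_ball M T x \<epsilon>))"
          using pos by (simp add: ln_div)
        moreover have "0 \<le> (4 :: real) ^ k" by simp
        ultimately have "4 ^ k \<le> ln (1 / prob (sup_ball M T x \<epsilon>)) powr 1"
          by simp
        then show ?thesis
          using False by (simp add: log_inv_powr_def ennreal_leI)
      qed (simp add: log_inv_powr_def)
    qed
    also have "\<dots> = log_inv_powr 1 (prob (sup_ball M T x \<epsilon>)) * indicator {0..} \<epsilon>"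
      using k l(1)[of k] by (simp add: I_def)
    finally show ?thesis .
  qed (auto simp: indicator_def intro!: sum.neutral)
  have "ennreal (\<Sum>k\<in>K. 4 ^ k * (l k / 2)) = (\<Sum>k\<in>K. ennreal (4 ^ k) * emeasure lborel (I k))"
  proof -
    have "ennreal (4 ^ k * (l k / 2)) = ennreal (4 ^ k) * emeasure lborel (I k)" for k
    proof -
      have "emeasure lborel (I k) = ennreal (l k / 2)"
        using l(1)[of k] by (simp add: I_def)
      then show ?thesis
        using l(1)[of k] by (simp only: ennreal_mult'' divide_nonneg_nonneg less_imp_le)
    qed
    then show ?thesis
      using l(1) by (subst sum_ennreal[symmetric]) (simp_all add: less_imp_le)
  qed
  also have "\<dots> = (\<integral>\<^sup>+\<epsilon>. (\<Sum>k\<in>K. ennreal (4 ^ k) * indicator (I k) \<epsilon>) \<partial>lborel)"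
    by (subst nn_integral_sum) (auto simp: I_def nn_integral_cmult_indicator)
  also have "\<dots> \<le> ennreal G"
    using nn_integral_mono[OF pw] G(1) by (rule order_trans)
  finally have le: "(\<Sum>k\<in>K. 4 ^ k * (l k / 2)) \<le> G"
    using G(2) by simp
  have "(\<Sum>k<n. if thin \<nu> M T k (r k) x then 2 ^ k * r k else 0) = (\<Sum>k\<in>K. 2 ^ k * r k)"
    unfolding K_def by (rule sum.inter_filter[symmetric]) simp
  also have "\<dots> = 4 * (\<Sum>k\<in>K. 4 ^ k * (l k / 2))"
    unfolding sum_distrib_left
  proof (rule sum.cong)
    fix k
    have "(4 :: real) ^ k = 2 ^ k * 2 ^ k" by (simp flip: power_mult_distrib)
    then show "2 ^ k * r k = 4 * (4 ^ k * (l k / 2))" by (simp add: l_def)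
  qed simp
  finally show ?thesis using le by simp
qed

section \<open>The majorizing measure\<close>

lemma pmf_bind_ge: "pmf N n * pmf (f n) y \<le> pmf (bind_pmf N f) y"
proof -
  have "pmf N n * pmf (f n) y = measure_pmf.expectation N (\<lambda>k. indicator {n} k * pmf (f n) y)"
    by (simp add: measure_pmf_single)
  also have "\<dots> \<le> measure_pmf.expectation N (\<lambda>k. pmf (f k) y)"
    by (intro integral_mono measure_pmf.integrable_const_bound[where B = 1])
      (auto simp: indicator_def pmf_le_1)
  finally show ?thesis
    by (simp add: pmf_bind)
qed

text \<open>
  The measure mixes, with geometric weights, the uniform distributions on the representatives of
  the pieces of each level.
\<close>
lemma gamma_half_le:
  fixes T :: "'a set" and lev :: "nat \<Rightarrow> 'p set" and r :: "'a \<Rightarrow> nat \<Rightarrow> real"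
  assumes "Metric_space T d"
    and lev: "\<And>n. finite (lev n)" "\<And>n. lev n \<noteq> {}" "\<And>n. real (card (lev n)) \<le> exp (2 * 4 ^ n)"
    and rep: "\<And>n p. p \<in> lev n \<Longrightarrow> rep p \<in> T"
    and branch: "\<And>x n. x \<in> T \<Longrightarrow> branch x n \<in> lev n"
    and r: "\<And>x n. x \<in> T \<Longrightarrow> 0 \<le> r x n" "\<And>x n. x \<in> T \<Longrightarrow> d x (rep (branch x n)) \<le> 2 * r x n"
    and diam: "\<And>x y. x \<in> T \<Longrightarrow> y \<in> T \<Longrightarrow> d x y \<le> 2 * r x 0"
    and B: "\<And>x n. x \<in> T \<Longrightarrow> (\<Sum>k<n. 2 ^ k * r x k) \<le> B"
  shows "\<gamma> (1/2) T d \<le> ennreal (8 * B)"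
proof -
  interpret Metric_space T d by fact
  define pm where "pm = bind_pmf (geometric_pmf (1/2)) (\<lambda>n. map_pmf rep (pmf_of_set (lev n)))"
  have set_pm: "set_pmf pm \<subseteq> T"
    using lev rep by (auto simp: pm_def)
  \<comment> \<open>Restricting a discrete law to T gives the power set as sigma-algebra, so all
    balls are measurable.\<close>
  define \<mu> where "\<mu> = restrict_space (measure_pmf pm) T"
  have \<mu>: "prob_space \<mu>" "space \<mu> = T" "sets \<mu> = Pow T"
    unfolding \<mu>_def using set_pm
    by (auto intro!: prob_space_restrict_space measure_pmf.emeasure_eq_1_AE
        simp: AE_measure_pmf_iff space_restrict_space sets_restrict_space)
  then have "\<mu> \<in> ball_measures T d"
    by (simp add: ball_measures_def mcball_subset_mspace)
  interpret \<mu>: prob_space \<mu> by fact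
  have mass: "(1/2) ^ (n + 1) * exp (- (2 * 4 ^ n)) \<le> measure \<mu> A"
    if "A \<subseteq> T" "p \<in> lev n" "rep p \<in> A" for A p n
  proof -
    have "exp (- (2 * 4 ^ n)) \<le> 1 / real (card (lev n))"
      using lev[of n] by (simp add: exp_minus inverse_eq_divide frac_le card_gt_0_iff)
    also have "\<dots> = measure (measure_pmf (pmf_of_set (lev n))) {p}"
      using that lev[of n] by (simp add: measure_pmf_single)
    also have "\<dots> \<le> pmf (map_pmf rep (pmf_of_set (lev n))) (rep p)"
      unfolding pmf_map by (intro measure_pmf.finite_measure_mono) auto
    finally have "(1/2) ^ (n + 1) * exp (- (2 * 4 ^ n)) \<le>
        pmf (geometric_pmf (1/2)) n * pmf (map_pmf rep (pmf_of_set (lev n))) (rep p)"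
      by (intro mult_mono) auto
    also have "\<dots> \<le> pmf pm (rep p)"
      unfolding pm_def by (rule pmf_bind_ge)
    also have "\<dots> = measure (measure_pmf pm) {rep p}"
      by (simp add: measure_pmf_single)
    also have "\<dots> \<le> measure (measure_pmf pm) A"
      using that by (intro measure_pmf.finite_measure_mono) auto
    also have "\<dots> = measure \<mu> A"
      unfolding \<mu>_def using that by (subst measure_restrict_space) auto
    finally show ?thesis .
  qed
  have log_le: "log_inv_powr (1/2) (measure \<mu> A) \<le> ennreal (2 * 2 ^ n)"
    if A: "A \<subseteq> T" "p \<in> lev n" "rep p \<in> A" for A p n
  proof -
    \<comment> \<open>The geometric weight costs a factor exp (-4^n) at most, so the logarithm stays
      below 3 * 4^n and its root below 2 * 2^n.\<close>
    have "n + 1 \<le> 4 ^ n"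
      by (induction n) auto
    then have "real (n + 1) \<le> real (4 ^ n)"
      by (rule of_nat_mono)
    then have n4: "real n + 1 \<le> 4 ^ n"
      by simp
    have "exp (- (3 * 4 ^ n)) \<le> exp (- (real n + 1)) * exp (- (2 * 4 ^ n))"
      using n4 by (simp flip: exp_add)
    also have "\<dots> \<le> (1/2) ^ (n + 1) * exp (- (2 * 4 ^ n))"
    proof (intro mult_right_mono)
      have "exp (-1 :: real) \<le> 1 / 2"
        using exp_ge_add_one_self[of 1] by (simp add: exp_minus field_simps)
      then have "exp (-1 :: real) ^ (n + 1) \<le> (1/2) ^ (n + 1)"
        by (intro power_mono) auto
      moreover have "exp (-1) ^ (n + 1) = exp (- (real n + 1))"
        unfolding exp_of_nat_mult[symmetric] by simp
      ultimately show "exp (- (real n + 1)) \<le> (1/2) ^ (n + 1)"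
        by simp
    qed auto
    also have "\<dots> \<le> measure \<mu> A" by (rule mass[OF A])
    finally have le: "exp (- (3 * 4 ^ n)) \<le> measure \<mu> A" .
    then have pos: "measure \<mu> A > 0"
      by (meson exp_gt_zero less_le_trans)
    then have "- (3 * 4 ^ n) \<le> ln (measure \<mu> A)"
      using le by (simp add: ln_ge_iff)
    then have "ln (1 / measure \<mu> A) \<le> 3 * 4 ^ n"
      using pos by (simp add: ln_div)
    also have "\<dots> \<le> (2 * 2 ^ n)\<^sup>2"
      by (simp add: power_mult_distrib power_mult[symmetric] mult.commute[of n]) (simp add: power_mult)
    finally have "sqrt (ln (1 / measure \<mu> A)) \<le> 2 * 2 ^ n"
      by (intro real_le_lsqrt) auto
    moreover have "0 \<le> ln (1 / measure \<mu> A)"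
      using pos by (simp add: ln_div)
    ultimately have "ln (1 / measure \<mu> A) powr (1/2) \<le> 2 * 2 ^ n"
      by (simp add: powr_half_sqrt)
    then show ?thesis
      using pos by (simp add: log_inv_powr_def ennreal_leI)
  qed
  have "(\<integral>\<^sup>+\<epsilon>\<in>{0..}. log_inv_powr (1/2) (measure \<mu> (mcball x \<epsilon>)) \<partial>lborel) \<le> ennreal (8 * B)"
    if x: "x \<in> T" for x
  proof -
    \<comment> \<open>\<open>t n\<close> dominates the integrand where N = n + 1 is the first level
      with 2 * r x N at most \<epsilon>; its height 4 * 2^n is 2 * 2^N.\<close>
    define t where "t = (\<lambda>n \<epsilon>. ennreal (4 * 2 ^ n) * indicator {0..2 * r x n} \<epsilon>)"
    have pw: "log_inv_powr (1/2) (measure \<mu> (mcball x \<epsilon>)) \<le> (\<Sum>n. t n \<epsilon>)" if \<epsilon>: "\<epsilon> > 0" for \<epsilon>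
    proof (cases "2 * r x 0 \<le> \<epsilon>")
      case True
      then have "mcball x \<epsilon> = T" using diam[OF x] x by (force intro: order_trans)
      then have "measure \<mu> (mcball x \<epsilon>) = 1"
        using \<mu>.prob_space \<mu>(2) by simp
      then show ?thesis by (simp add: log_inv_powr_def)
    next
      case False
      have "\<exists>n. 2 * r x n \<le> \<epsilon>"
      proof -
        obtain n where n: "2 * B / \<epsilon> < 2 ^ n"
          using real_arch_pow[of 2 "2 * B / \<epsilon>"] by auto
        have "2 ^ n * r x n \<le> (\<Sum>k<Suc n. 2 ^ k * r x k)"
          using r(1)[OF x] by (intro member_le_sum) auto
        also have "\<dots> \<le> B" by (rule B[OF x])
        finally have "2 ^ n * r x n \<le> B" .
        moreover have "2 * B < 2 ^ n * \<epsilon>" using n \<epsilon> by (simp add: field_simps)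
        ultimately have "2 ^ n * (2 * r x n) < 2 ^ n * \<epsilon>" by linarith
        then have "2 * r x n < \<epsilon>"
          by (rule mult_left_less_imp_less) simp
        then show ?thesis by (auto intro: less_imp_le)
      qed
      then obtain N where N: "2 * r x N \<le> \<epsilon>" and min: "\<And>k. k < N \<Longrightarrow> \<not> 2 * r x k \<le> \<epsilon>"
        using exists_least_iff[of "\<lambda>n. 2 * r x n \<le> \<epsilon>"] by blast
      have "N \<noteq> 0" using N False by metis
      then obtain n where n: "N = Suc n" using not0_implies_Suc by blast
      have "log_inv_powr (1/2) (measure \<mu> (mcball x \<epsilon>)) \<le> ennreal (2 * 2 ^ N)"
        using branch[OF x, of N] rep r(2)[OF x, of N] N x by (intro log_le[of _ "branch x N"]) auto
      also have "\<dots> = t n \<epsilon>"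
        using min[of n] \<epsilon> by (simp add: n t_def)
      also have "\<dots> = (\<Sum>k\<in>{n}. t k \<epsilon>)" by simp
      also have "\<dots> \<le> (\<Sum>n. t n \<epsilon>)"
        by (intro sum_le_suminf) auto
      finally show ?thesis .
    qed
    have "(\<integral>\<^sup>+\<epsilon>\<in>{0..}. log_inv_powr (1/2) (measure \<mu> (mcball x \<epsilon>)) \<partial>lborel) \<le>
        (\<integral>\<^sup>+\<epsilon>. (\<Sum>n. t n \<epsilon>) \<partial>lborel)"
    \<comment> \<open>At \<epsilon> = 0 there may be no level of sufficiently small radius, so this
      point is dropped as a null set.\<close>
    proof (intro nn_integral_mono_AE)
      show "AE \<epsilon> in lborel. log_inv_powr (1/2) (measure \<mu> (mcball x \<epsilon>)) * indicator {0..} \<epsilon> \<le> (\<Sum>n. t n \<epsilon>)"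
        using AE_lborel_singleton[of "0 :: real"]
      proof eventually_elim
        case (elim \<epsilon>)
        then show ?case using pw[of \<epsilon>] by (cases "\<epsilon> > 0") auto
      qed
    qed
    also have "\<dots> = (\<Sum>n. \<integral>\<^sup>+\<epsilon>. t n \<epsilon> \<partial>lborel)"
      unfolding t_def by (intro nn_integral_suminf) auto
    also have "\<dots> = (\<Sum>n. ennreal (8 * (2 ^ n * r x n)))"
    proof (intro arg_cong[where f = suminf] ext)
      fix n
      have "(\<integral>\<^sup>+\<epsilon>. t n \<epsilon> \<partial>lborel) = ennreal (4 * 2 ^ n) * ennreal (2 * r x n)"
        unfolding t_def using r(1)[OF x, of n] by (subst nn_integral_cmult_indicator) auto
      also have "\<dots> = ennreal (8 * (2 ^ n * r x n))"
        using r(1)[OF x, of n] by (subst ennreal_mult[symmetric]) auto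
      finally show "(\<integral>\<^sup>+\<epsilon>. t n \<epsilon> \<partial>lborel) = ennreal (8 * (2 ^ n * r x n))" .
    qed
    also have "\<dots> \<le> ennreal (8 * B)"
    proof (rule suminf_le_const)
      fix n
      have "(\<Sum>k<n. ennreal (8 * (2 ^ k * r x k))) = ennreal (8 * (\<Sum>k<n. 2 ^ k * r x k))"
        unfolding sum_distrib_left using r(1)[OF x] by (intro sum_ennreal) auto
      also have "\<dots> \<le> ennreal (8 * B)"
        using B[OF x] by (intro ennreal_leI mult_left_mono) auto
      finally show "(\<Sum>k<n. ennreal (8 * (2 ^ k * r x k))) \<le> ennreal (8 * B)" .
    qed simp
    finally show ?thesis .
  qed
  then show ?thesis
    unfolding \<gamma>_def using \<open>\<mu> \<in> ball_measures T d\<close> by (intro INF_lower2[of \<mu>] SUP_least) auto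
qed

lemma gamma_half_le_width:
  assumes M: "M \<ge> 1" and T: "T \<subseteq> topspace (Euclidean_space M)" "T \<noteq> {}"
    and \<nu>: "\<nu> \<in> ball_measures T (dist_sup M)"
    and G: "\<And>x. x \<in> T \<Longrightarrow> (\<integral>\<^sup>+\<epsilon>\<in>{0..}. log_inv_powr 1
      (measure \<nu> (Metric_space.mcball T (dist_sup M) x \<epsilon>)) \<partial>lborel) \<le> ennreal G" "G \<ge> 0"
    and W: "width_le M T W" and "\<delta> > 0"
  shows "\<gamma> (1/2) T (dist2 M) \<le> ennreal (8 * (62914568 * W + 20 * G + 4 * \<delta>))"
proof -
  interpret sup: Metric_space T "dist_sup M"
    using Metric_space.subspace[OF Metric_space_dist_sup[OF M] T(1)] .
  have ball: "Metric_space.mcball T (dist_sup M) x \<epsilon> = sup_ball M T x \<epsilon>" if "x \<in> T" for x \<epsilon>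
    using that by auto
  have prob: "prob_space \<nu>" and meas: "\<And>x r. x \<in> T \<Longrightarrow> sup_ball M T x r \<in> sets \<nu>"
    using \<nu> ball unfolding ball_measures_def by auto
  have G': "(\<integral>\<^sup>+\<epsilon>\<in>{0..}. log_inv_powr 1 (measure \<nu> (sup_ball M T x \<epsilon>)) \<partial>lborel) \<le> ennreal G"
    if "x \<in> T" for x
    using G(1)[OF that] unfolding ball[OF that] .
  have W0: "W \<ge> 0"
  proof -
    obtain t where "t \<in> T" using T by blast
    then have "expected_max M {t} \<le> W" using W by (simp add: width_le_def)
    then show ?thesis using expected_max_nonneg[of "{t}" M] by simp
  qed
  \<comment> \<open>Khintchine bounds the diameter by 18/5 * W, which is below 2 * a; \<delta> keeps
    the radius positive when W = 0.\<close>
  define a where "a = 2 * W + \<delta>"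
  have a: "a > 0" using W0 \<open>\<delta> > 0\<close> by (simp add: a_def)
  have diam: "dist2 M x y \<le> 2 * a" if "x \<in> T" "y \<in> T" for x y
  proof -
    have "expected_max M {x, y} \<le> W" using W that by (simp add: width_le_def)
    then show ?thesis
      using dist2_le_expected_max[of M x y] W0 \<open>\<delta> > 0\<close> by (simp add: a_def)
  qed
  define p0 where "p0 = Piece T a W W W W"
  have p0: "valid_piece M T p0" "pts p0 = T"
    using a diam T(2) W by (auto simp: valid_piece_def p0_def intro: width_le_mono)
  obtain lev branch where lev: "\<And>n. finite (lev n)" "\<And>n. lev n \<noteq> {}"
      "\<And>n. real (card (lev n)) \<le> exp (2 * 4 ^ n)" "\<And>n p. p \<in> lev n \<Longrightarrow> valid_piece M T p"
    and "\<And>x. x \<in> pts p0 \<Longrightarrow> branch x 0 = p0" "\<And>x n. x \<in> pts p0 \<Longrightarrow> branch x n \<in> lev n"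
      "\<And>x n. x \<in> pts p0 \<Longrightarrow> x \<in> pts (branch x n)"
      "\<And>x n. x \<in> pts p0 \<Longrightarrow> step \<nu> M T n (branch x n) (branch x (Suc n))"
    by (rule piece_tree[OF prob _ p0(1)]) (erule meas, rule that)
  note branch = this(5-8)[unfolded p0(2)]
  have valid: "valid_piece M T (branch x n)" if "x \<in> T" for x n
    using lev(4) branch(2)[OF that] by blast
  define rep where "rep = (\<lambda>p. SOME y. y \<in> pts p)"
  have rep: "rep p \<in> pts p" if "valid_piece M T p" for p
  proof -
    have "\<exists>y. y \<in> pts p"
      using that by (auto simp: valid_piece_def)
    then show ?thesis
      unfolding rep_def by (rule someI_ex)
  qed
  have rad: "rad (branch x n) > 0" if "x \<in> T" for x n
    using valid[OF that] by (simp add: valid_piece_def)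
  show ?thesis
  proof (rule gamma_half_le[of T "dist2 M" lev rep branch "\<lambda>x n. rad (branch x n)"])
    show "Metric_space T (dist2 M)"
      using Metric_space.subspace[OF Metric_space_dist2 T(1)] .
    show "rep p \<in> T" if "p \<in> lev n" for n p
      using rep[OF lev(4)[OF that]] lev(4)[OF that] by (auto simp: valid_piece_def)
    show "dist2 M x (rep (branch x n)) \<le> 2 * rad (branch x n)" if "x \<in> T" for x n
      using valid_piece_diam[OF valid branch(3) rep[OF valid]] that by blast
    show "dist2 M x y \<le> 2 * rad (branch x 0)" if "x \<in> T" "y \<in> T" for x y
      using diam[OF that] branch(1)[OF that(1)] by (simp add: p0_def)
    show "(\<Sum>k<n. 2 ^ k * rad (branch x k)) \<le> 62914568 * W + 20 * G + 4 * \<delta>" if x: "x \<in> T" for x n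
    proof -
      have "(\<Sum>k<n. 2 ^ k * rad (branch x k)) \<le> 62914560 * W +
          5 * (\<Sum>k<n. if thin \<nu> M T k (rad (branch x k)) x then 2 ^ k * rad (branch x k) else 0) +
          4 * rad (branch x 0)"
        by (rule path_sum_le[OF valid branch(4) branch(3)]) (simp_all add: x branch(1) p0_def)
      also have "(\<Sum>k<n. if thin \<nu> M T k (rad (branch x k)) x then 2 ^ k * rad (branch x k) else 0) \<le> 4 * G"
      proof (rule thin_sum_le[OF prob meas[OF x] rad[OF x] _ G'[OF x] G(2)])
        show "rad (branch x (Suc k)) \<le> rad (branch x k)" for k
          using branch(4)[OF x, of k] rad[OF x, of k]
          by (auto simp: step_def keeps_def shrinks_def gains_def)
      qed
      \<comment> \<open>Here 20 * G is 5 * (4 * G), and the root contributes 4 * a = 8 * W + 4 *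
        \<delta>, which turns 62914560 into 62914568.\<close>
      finally show ?thesis
        using branch(1)[OF x] by (simp add: p0_def a_def)
    qed
  qed (use lev branch rad in \<open>auto simp: less_imp_le\<close>)
qed

theorem theorem1p2:
  shows "\<exists>K::real. K > 0 \<and>
    (\<forall>(M::nat) T. M \<ge> 1 \<longrightarrow> T \<subseteq> topspace (Euclidean_space M) \<longrightarrow> T \<noteq> {} \<longrightarrow>
      \<gamma> (1/2) T (dist2 M) \<le> ennreal K * (b M T + \<gamma> 1 T (dist_sup M)))"
proof (intro exI[of _ 503316544] conjI allI impI)
  fix M :: nat and T assume M: "M \<ge> 1" and T: "T \<subseteq> topspace (Euclidean_space M)" "T \<noteq> {}"
  show "\<gamma> (1/2) T (dist2 M) \<le> ennreal 503316544 * (b M T + \<gamma> 1 T (dist_sup M))"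
  proof (cases "b M T = \<infinity> \<or> \<gamma> 1 T (dist_sup M) = \<infinity>")
    case True
    then show ?thesis by (auto simp: ennreal_mult_top)
  next
    case False
    then obtain W g where W: "b M T = ennreal W" "W \<ge> 0" and g: "\<gamma> 1 T (dist_sup M) = ennreal g" "g \<ge> 0"
      by (metis ennreal_cases infinity_ennreal_def)
    have width: "width_le M T W"
      unfolding width_le_def
    proof (intro allI impI)
      fix S assume S: "finite S" "S \<noteq> {}" "S \<subseteq> T"
      then have "ennreal (expected_max M S) \<le> b M T"
        unfolding b_def by (intro SUP_upper) auto
      then show "expected_max M S \<le> W"
        using W by simp
    qed
    show ?thesis
    proof (rule ennreal_le_epsilon)
      fix e :: real assume e: "e > 0"
      \<comment> \<open>192 = 8 * (20 + 4) collects the near-optimality of \<nu> and the slack in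
        the root radius.\<close>
      define \<delta> where "\<delta> = e / 192"
      have \<delta>: "\<delta> > 0" using e by (simp add: \<delta>_def)
      have "\<gamma> 1 T (dist_sup M) < ennreal (g + \<delta>)"
        using g \<delta> by (simp add: ennreal_lessI)
      then obtain \<nu> where \<nu>: "\<nu> \<in> ball_measures T (dist_sup M)"
        and lt: "(SUP x\<in>T. \<integral>\<^sup>+\<epsilon>\<in>{0..}. log_inv_powr 1
          (measure \<nu> (Metric_space.mcball T (dist_sup M) x \<epsilon>)) \<partial>lborel) < ennreal (g + \<delta>)"
        unfolding \<gamma>_def INF_less_iff by blast
      have "\<gamma> (1/2) T (dist2 M) \<le> ennreal (8 * (62914568 * W + 20 * (g + \<delta>) + 4 * \<delta>))"
        using g \<delta> by (intro gamma_half_le_width[OF M T \<nu>] width order_trans[OF SUP_upper less_imp_le[OF lt]]) auto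
      also have "\<dots> \<le> ennreal (503316544 * (W + g) + e)"
        using g by (intro ennreal_leI) (simp add: \<delta>_def algebra_simps)
      also have "\<dots> = ennreal 503316544 * (b M T + \<gamma> 1 T (dist_sup M)) + ennreal e"
        using W g e by (simp add: ennreal_plus ennreal_mult distrib_left)
      finally show "\<gamma> (1/2) T (dist2 M) \<le> ennreal 503316544 * (b M T + \<gamma> 1 T (dist_sup M)) + ennreal e" .
    qed
  qed
qed simp

end
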